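(* Let $n \geq 1$. The set \[ \{A_1 \odot \cdots \odot A_k \mid k \geq 1,\ A_1,\ldots,A_k \in D_n\} \subseteq \mathbb{R}_{\geq 0}^{n\times n} \] is the support of a finite polyhedral fan of dimension $\binom{n}{2}$. Moreover, its topological closure in $[0,\infty]^{n\times n}$ (with the product topology) equals the monoid $G_n$ generated under $\odot$ by the matrices $C_{kl}(a)$ with $k,l \in [n]$ distinct and $a \in [0,\infty]$.
   Context: $[n]=\{1,\ldots,n\}$. $D_n$ is the set of metric $n\times n$ matrices: matrices $(a_{ij})$ with entries in $\mathbb{R}_{\geq 0}$ such that $a_{ii}=0$, $a_{ij}=a_{ji}$ and $a_{ij}+a_{jk}\geq a_{ik}$ for all $i,j,k$. Tropical (min-plus) matrix multiplication is $(A\odot B)_{ij}=\min_k (a_{ik}+b_{kj})$, with the usual conventions for $\infty$. $[0,\infty]$ carries the topology of the one-point compactification of $[0,\infty)$ (a compact closed interval). For distinct $k,l\in[n]$ and $a\in[0,\infty]$, the lossy phone call matrix $C_{kl}(a)$ is the $n\times n$ matrix with zeroes on the diagonal, entry $a$ at positions $(k,l)$ and $(l,k)$, and $\infty$ everywhere else. The monoid $G_n$ contains the tropical identity (zeros on the diagonal, $\infty$ elsewhere). *)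

theory Defs
  imports "HOL-Analysis.Analysis"
begin

text \<open>The index set \<open>[n]\<close> is the universe of a finite type \<open>'n\<close>, so \<open>n = CARD('n) \<ge> 1\<close>.
  The interval \<open>[0,\<infinity>]\<close> is \<^typ>\<open>ennreal\<close>, whose order topology is that of the one-point
  compactification of \<open>[0,\<infinity>)\<close>; the topology on \<open>ennreal ^ 'n ^ 'n\<close> is the product topology.\<close>

definition trop_mult ::
  "('a::{linorder,plus}) ^ 'n ^ 'n \<Rightarrow> 'a ^ 'n ^ 'n \<Rightarrow> 'a ^ 'n ^ 'n" (infixl "\<odot>" 70)
  where "A \<odot> B = (\<chi> i j. Min (range (\<lambda>k. A $ i $ k + B $ k $ j)))"

definition metric_matrices :: "(real ^ 'n ^ 'n) set" where
  "metric_matrices = {A. (\<forall>i j. 0 \<le> A $ i $ j) \<and> (\<forall>i. A $ i $ i = 0) \<and>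
     (\<forall>i j. A $ i $ j = A $ j $ i) \<and> (\<forall>i j k. A $ i $ k \<le> A $ i $ j + A $ j $ k)}"

definition metric_products :: "(real ^ 'n ^ 'n) set" where
  "metric_products =
     {foldl (\<odot>) A As | A As. A \<in> metric_matrices \<and> set As \<subseteq> metric_matrices}"

definition trop_one :: "ennreal ^ 'n ^ 'n" where
  "trop_one = (\<chi> i j. if i = j then 0 else \<infinity>)"

definition lossy_call :: "'n \<Rightarrow> 'n \<Rightarrow> ennreal \<Rightarrow> ennreal ^ 'n ^ 'n" where
  "lossy_call k l a = (\<chi> i j. if i = j then 0
     else if i = k \<and> j = l \<or> i = l \<and> j = k then a else \<infinity>)"

inductive_set trop_monoid_gen :: "(ennreal ^ 'n ^ 'n) set \<Rightarrow> (ennreal ^ 'n ^ 'n) set"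
  for S where
  one: "trop_one \<in> trop_monoid_gen S"
| gen: "A \<in> S \<Longrightarrow> A \<in> trop_monoid_gen S"
| mult: "A \<in> trop_monoid_gen S \<Longrightarrow> B \<in> trop_monoid_gen S \<Longrightarrow> A \<odot> B \<in> trop_monoid_gen S"

definition lossy_gossip_monoid :: "(ennreal ^ 'n ^ 'n) set" where
  "lossy_gossip_monoid = trop_monoid_gen {lossy_call k l a | k l a. k \<noteq> l}"

text \<open>Used only on nonnegative matrices, where it is the inclusion of \<open>[0,\<infinity>)\<close>-matrices into
  \<open>[0,\<infinity>]\<close>-matrices.\<close>

definition ennreal_matrix :: "real ^ 'n ^ 'n \<Rightarrow> ennreal ^ 'n ^ 'n" where
  "ennreal_matrix A = (\<chi> i j. ennreal (A $ i $ j))"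

text \<open>The library counts \<open>{}\<close> as a cone, as a polyhedron and as a face of every set, hence the
  explicit nonemptiness conditions.\<close>

definition polyhedral_cone :: "'a::euclidean_space set \<Rightarrow> bool" where
  "polyhedral_cone C \<longleftrightarrow> polyhedron C \<and> cone C \<and> C \<noteq> {}"

definition finite_polyhedral_fan :: "'a::euclidean_space set set \<Rightarrow> bool" where
  "finite_polyhedral_fan F \<longleftrightarrow> finite F \<and> F \<noteq> {} \<and>
     (\<forall>C\<in>F. polyhedral_cone C) \<and>
     (\<forall>C\<in>F. \<forall>T. T face_of C \<and> T \<noteq> {} \<longrightarrow> T \<in> F) \<and>
     (\<forall>C\<in>F. \<forall>C'\<in>F. C \<inter> C' face_of C \<and> C \<inter> C' face_of C')"

definition fan_dim :: "'a::euclidean_space set set \<Rightarrow> int" where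
  "fan_dim F = Max (aff_dim ` F)"

end

theory Submission
  imports Defs
begin

text \<open>
  A call with loss \<open>a\<close> between \<open>k\<close> and \<open>l\<close> updates two columns of a matrix, and an entry of a product
  of calls is the weight of a shortest time-respecting path. Shortest paths may be taken simple, so a
  bounded number of calls suffices for every element of the monoid; hence the monoid is a finite union
  of continuous images of cubes \<open>[0,\<infinity>]\<^sup>N\<close>, and so compact. Its matrices with finite entries are exactly
  the products of metric matrices: a large finite constant can replace \<open>\<infinity>\<close>.

  On finite matrices the parametrization by losses is piecewise linear, and eliminating the losses one
  by one shows that the set of products is a union of sign classes of a finite set of linear forms. The
  closures of these sign classes form the fan.

  For the dimension, replace the call with loss \<open>a\<close> by the rotation in the plane \<open>(k, l)\<close> with sine
  \<open>exp (- a u)\<close> and let \<open>u\<close> tend to infinity. For generic losses the logarithmic derivatives of the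
  entries of the product of rotations converge to the coefficients of the linear forms describing the
  entries of the product of calls. The derivatives lie in a translate \<open>M K\<close> of the skew-symmetric
  matrices \<open>K\<close>, so their rank, and that of their limits, is at most \<open>n choose 2\<close>. Metric matrices
  alone already attain this dimension.
\<close>

section \<open>Products of calls\<close>

text \<open>The obstacle is the upper bound on the dimension: a product may involve about n^3
  losses, so counting parameters is useless. Rotations help because the tangent space of the
  orthogonal group has dimension n choose 2 however many factors a product has. A sum of terms of
  order exp (- x u) and exp (- y u) has order exp (- (min x y) u), but rotations also contain minus
  signs, so leading terms of equal order might cancel. Generic losses exclude ties in every minimum,
  and each entry keeps a single leading term with a nonzero coefficient. A zero entry has no
  exponent, so the products of rotations start at a matrix with off-diagonal entries exp (- b u),
  the counterpart of using a real \<open>b\<close> for \<open>\<infinity>\<close>. Choosing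
  \<open>b\<close> above all entries of the result makes \<open>b\<close> disappear from the linear
  forms again. Passing from generic to arbitrary losses is a limit argument: the forms have
  coefficients 0 and 1, so only finitely many subspaces arise and their union is closed.\<close>

text \<open>The type is general because over \<open>real\<close>, where \<open>\<infinity>\<close>
  does not exist, a call is not a matrix and only its effect on columns makes sense.\<close>

definition call_update :: "'n \<Rightarrow> 'n \<Rightarrow> 'a::{linorder,plus} \<Rightarrow> 'a ^ 'n ^ 'n \<Rightarrow> 'a ^ 'n ^ 'n" where
  "call_update k l a X = (\<chi> i j. if j = k then min (X $ i $ k) (X $ i $ l + a)
     else if j = l then min (X $ i $ l) (X $ i $ k + a) else X $ i $ j)"

text \<open>The head of the list is the last call.\<close>

primrec calls :: "'a::{linorder,plus} ^ 'n ^ 'n \<Rightarrow> ('n \<times> 'n \<times> 'a) list \<Rightarrow> 'a ^ 'n ^ 'n" where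
  "calls X [] = X"
| "calls X (c # cs) = call_update (fst c) (fst (snd c)) (snd (snd c)) (calls X cs)"

abbreviation proper_calls :: "('n \<times> 'n \<times> 'a) list \<Rightarrow> bool" where
  "proper_calls cs \<equiv> (\<forall>c \<in> set cs. fst c \<noteq> fst (snd c))"

lemma trop_mult_le: "(A \<odot> B) $ i $ j \<le> A $ i $ k + B $ k $ j" for A :: "('a::{linorder,plus}) ^ 'n::finite ^ 'n"
  unfolding trop_mult_def by (simp add: Min_le)

lemma trop_mult_attained: "\<exists>k. (A \<odot> B) $ i $ j = A $ i $ k + B $ k $ j"
  for A :: "('a::{linorder,plus}) ^ 'n::finite ^ 'n"
proof -
  have "Min (range (\<lambda>k. A $ i $ k + B $ k $ j)) \<in> range (\<lambda>k. A $ i $ k + B $ k $ j)"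
    by (intro Min_in) auto
  then obtain k where "Min (range (\<lambda>k. A $ i $ k + B $ k $ j)) = A $ i $ k + B $ k $ j" by blast
  then show ?thesis unfolding trop_mult_def by auto
qed

lemma trop_mult_eqI:
  fixes A :: "('a::{linorder,plus}) ^ 'n::finite ^ 'n"
  assumes "\<And>i j k. C $ i $ j \<le> A $ i $ k + B $ k $ j"
    and "\<And>i j. \<exists>k. A $ i $ k + B $ k $ j \<le> C $ i $ j"
  shows "A \<odot> B = C"
proof -
  have "(A \<odot> B) $ i $ j = C $ i $ j" for i j
  proof (rule antisym)
    obtain k where "A $ i $ k + B $ k $ j \<le> C $ i $ j" using assms(2) by blast
    then show "(A \<odot> B) $ i $ j \<le> C $ i $ j" using trop_mult_le[of A B i j k] by simp
    obtain k where "(A \<odot> B) $ i $ j = A $ i $ k + B $ k $ j" using trop_mult_attained by blast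
    then show "C $ i $ j \<le> (A \<odot> B) $ i $ j" using assms(1) by simp
  qed
  then show ?thesis by (simp add: vec_eq_iff)
qed

lemma trop_mult_assoc:
  fixes A B C :: "ennreal ^ 'n::finite ^ 'n"
  shows "A \<odot> B \<odot> C = A \<odot> (B \<odot> C)"
proof (rule trop_mult_eqI)
  fix i j k
  obtain l where l: "(A \<odot> B) $ i $ k = A $ i $ l + B $ l $ k" using trop_mult_attained by blast
  have "(A \<odot> (B \<odot> C)) $ i $ j \<le> A $ i $ l + (B \<odot> C) $ l $ j" by (rule trop_mult_le)
  also have "\<dots> \<le> A $ i $ l + (B $ l $ k + C $ k $ j)" by (intro add_left_mono trop_mult_le)
  finally show "(A \<odot> (B \<odot> C)) $ i $ j \<le> (A \<odot> B) $ i $ k + C $ k $ j" by (simp add: l add.assoc)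
next
  fix i j
  obtain k where k: "(A \<odot> (B \<odot> C)) $ i $ j = A $ i $ k + (B \<odot> C) $ k $ j" using trop_mult_attained by blast
  obtain l where l: "(B \<odot> C) $ k $ j = B $ k $ l + C $ l $ j" using trop_mult_attained by blast
  have "(A \<odot> B) $ i $ l + C $ l $ j \<le> (A $ i $ k + B $ k $ l) + C $ l $ j"
    by (intro add_right_mono trop_mult_le)
  then show "\<exists>k. (A \<odot> B) $ i $ k + C $ k $ j \<le> (A \<odot> (B \<odot> C)) $ i $ j"
    using k l by (metis add.assoc)
qed

lemma trop_one_left [simp]: "trop_one \<odot> A = A"
proof (rule trop_mult_eqI)
  show "\<exists>k. trop_one $ i $ k + A $ k $ j \<le> A $ i $ j" for i j
    by (rule exI[of _ i]) (simp add: trop_one_def)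
qed (auto simp: trop_one_def)

lemma trop_one_right [simp]: "A \<odot> trop_one = A"
proof (rule trop_mult_eqI)
  show "\<exists>k. A $ i $ k + trop_one $ k $ j \<le> A $ i $ j" for i j
    by (rule exI[of _ j]) (simp add: trop_one_def)
qed (auto simp: trop_one_def)

lemma trop_mult_lossy_call:
  fixes X :: "ennreal ^ 'n::finite ^ 'n"
  assumes "k \<noteq> l"
  shows "X \<odot> lossy_call k l a = call_update k l a X"
proof (rule trop_mult_eqI)
  show "call_update k l a X $ i $ j \<le> X $ i $ q + lossy_call k l a $ q $ j" for i j q
    by (auto simp: call_update_def lossy_call_def min_le_iff_disj)
  show "\<exists>q. X $ i $ q + lossy_call k l a $ q $ j \<le> call_update k l a X $ i $ j" for i j
  proof -
    consider "j = k" "X $ i $ l + a < X $ i $ k" | "j = l" "X $ i $ k + a < X $ i $ l"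
      | "call_update k l a X $ i $ j = X $ i $ j"
      using assms unfolding call_update_def min_def vec_lambda_beta by (metis not_le)
    then show ?thesis
    proof cases
      case 1
      then show ?thesis using assms by (intro exI[of _ l]) (simp add: call_update_def lossy_call_def)
    next
      case 2
      then show ?thesis using assms by (intro exI[of _ k]) (simp add: call_update_def lossy_call_def)
    next
      case 3
      then show ?thesis by (intro exI[of _ j]) (simp add: lossy_call_def)
    qed
  qed
qed

lemma trop_mult_calls:
  fixes X Y :: "ennreal ^ 'n::finite ^ 'n"
  assumes "proper_calls cs"
  shows "X \<odot> calls Y cs = calls (X \<odot> Y) cs"
  using assms by (induction cs) (auto simp: trop_mult_lossy_call[symmetric] trop_mult_assoc[symmetric])

lemma calls_append: "calls X (cs @ ds) = calls (calls X ds) cs"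
  by (induction cs) auto

theorem lossy_gossip_monoid_eq:
  "(lossy_gossip_monoid :: (ennreal ^ 'n::finite ^ 'n) set) = {calls trop_one cs |cs. proper_calls cs}"
proof (intro equalityI subsetI)
  fix X :: "ennreal ^ 'n ^ 'n" assume "X \<in> lossy_gossip_monoid"
  then show "X \<in> {calls trop_one cs |cs. proper_calls cs}"
    unfolding lossy_gossip_monoid_def
  proof induction
    case one then show ?case by (auto intro: exI[of _ "[]"])
  next
    case (gen A)
    then obtain k l a where "k \<noteq> l" "A = lossy_call k l a" by auto
    then have "A = calls trop_one [(k, l, a)]" by (simp add: trop_mult_lossy_call[symmetric])
    with \<open>k \<noteq> l\<close> show ?case by (auto intro!: exI[of _ "[(k, l, a)]"])
  next
    case (mult A B)
    then obtain cs ds where "A = calls trop_one cs" "B = calls trop_one ds"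
      "proper_calls cs" "proper_calls ds" by auto
    \<comment> \<open>The last call heads a list, so the calls of the right factor go in
      front.\<close>
    then have "A \<odot> B = calls trop_one (ds @ cs)" "proper_calls (ds @ cs)"
      by (auto simp: trop_mult_calls calls_append)
    then show ?case by blast
  qed
next
  fix X :: "ennreal ^ 'n ^ 'n" assume "X \<in> {calls trop_one cs |cs. proper_calls cs}"
  then obtain cs where "X = calls trop_one cs" "proper_calls cs" by auto
  then show "X \<in> lossy_gossip_monoid"
    unfolding lossy_gossip_monoid_def
  proof (induction cs arbitrary: X)
    case Nil then show ?case by (simp add: trop_monoid_gen.one)
  next
    case (Cons c cs)
    then have "X = calls trop_one cs \<odot> lossy_call (fst c) (fst (snd c)) (snd (snd c))"
      by (simp add: trop_mult_lossy_call)
    moreover have "lossy_call (fst c) (fst (snd c)) (snd (snd c)) \<in> {lossy_call k l a |k l a. k \<noteq> l}"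
      using Cons.prems by fastforce
    moreover have "calls trop_one cs \<in> trop_monoid_gen {lossy_call k l a |k l a. k \<noteq> l}"
      using Cons by simp
    ultimately show ?case by (simp only: trop_monoid_gen.mult trop_monoid_gen.gen)
  qed
qed

section \<open>Bounding the number of calls\<close>

lemma call_update_le: "call_update k l a X $ i $ j \<le> X $ i $ j"
  by (auto simp: call_update_def)

lemma calls_le: "calls X cs $ i $ j \<le> X $ i $ j"
  by (induction cs) (auto intro: order_trans[OF call_update_le])

lemma call_update_mono:
  fixes X Y :: "'a::{linorder,ordered_ab_semigroup_add} ^ 'n ^ 'n"
  assumes "\<And>i j. X $ i $ j \<le> Y $ i $ j"
  shows "call_update k l a X $ i $ j \<le> call_update k l a Y $ i $ j"
  using min.mono[OF assms add_right_mono[OF assms]] by (simp add: call_update_def assms)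

text \<open>A call never raises an entry and respects the entrywise order, so removing calls can
  only raise the result. Position sets are used so that selections made for different entries can be
  united.\<close>

lemma calls_nths_antimono:
  fixes X :: "'a::{linorder,ordered_ab_semigroup_add} ^ 'n ^ 'n"
  assumes "I \<subseteq> J"
  shows "calls X (nths cs J) $ i $ j \<le> calls X (nths cs I) $ i $ j"
  using assms
proof (induction cs arbitrary: I J i j)
  case Nil then show ?case by simp
next
  case (Cons c cs)
  have IH: "calls X (nths cs {j. Suc j \<in> J}) $ i $ j \<le> calls X (nths cs {j. Suc j \<in> I}) $ i $ j" for i j
    using Cons.prems by (intro Cons.IH) auto
  have IH': "call_update k l a (calls X (nths cs {j. Suc j \<in> J})) $ i $ j
      \<le> calls X (nths cs {j. Suc j \<in> I}) $ i $ j" for k l a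
    by (rule order_trans[OF call_update_le IH])
  show ?case
    using Cons.prems IH IH' call_update_mono[OF IH] by (auto simp: nths_Cons)
qed

text \<open>The set \<open>V\<close> holds the vertices that an optimal path from \<open>i\<close> to \<open>j\<close>, traced backwards in time,
  may still visit: each call that strictly improves the current entry removes a vertex from it.\<close>

lemma few_calls_for_entry:
  fixes X :: "ennreal ^ 'n::finite ^ 'n"
  assumes "j \<in> V" and "\<And>v. v \<notin> V \<Longrightarrow> calls X cs $ i $ j < calls X cs $ i $ v"
  shows "\<exists>I. finite I \<and> card I \<le> card V \<and> calls X (nths cs I) $ i $ j \<le> calls X cs $ i $ j"
  using assms
proof (induction cs arbitrary: j V)
  case Nil
  show ?case by (intro exI[of _ "{}"]) auto
next
  case (Cons c cs)
  obtain k l a where c: "c = (k, l, a)" by (cases c) auto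
  let ?Y = "calls X cs" and ?Z = "calls X (c # cs)"
  have le: "?Z $ i $ v \<le> ?Y $ i $ v" for v using call_update_le by simp
  show ?case
  proof (cases "?Z $ i $ j = ?Y $ i $ j")
    case True
    have "?Y $ i $ j < ?Y $ i $ v" if "v \<notin> V" for v
      using Cons.prems(2)[OF that] True le[of v] by simp
    from Cons.IH[OF Cons.prems(1) this] obtain I where
      I: "finite I" "card I \<le> card V" "calls X (nths cs I) $ i $ j \<le> ?Y $ i $ j" by blast
    \<comment> \<open>The head call leaves this entry alone: skip position \<open>0\<close> and
      shift the positions found for \<open>cs\<close>.\<close>
    have "{m. Suc m \<in> Suc ` I} = I" by auto
    with I True show ?thesis
      by (intro exI[of _ "Suc ` I"]) (auto simp: nths_Cons card_image)
  next
    case False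
    \<comment> \<open>The vertex \<open>q\<close> is the other end of the call, the predecessor of
      \<open>j\<close> on the optimal path.\<close>
    then obtain q where q: "?Z $ i $ j = ?Y $ i $ q + a" "?Y $ i $ q + a < ?Y $ i $ j"
      "j = k \<and> q = l \<or> j = l \<and> q = k"
      by (auto simp: c call_update_def min_def not_le split: if_splits)
    have qj: "q \<noteq> j" using q(2) by (auto simp: leD)
    have "?Y $ i $ q \<le> ?Z $ i $ j" unfolding q(1) by simp
    \<comment> \<open>Outside \<open>V\<close> the value at \<open>q\<close> would exceed the new
      value at \<open>j\<close>, but the latter is the old value at \<open>q\<close> plus
      \<open>a\<close>.\<close>
    then have qV: "q \<in> V - {j}" using Cons.prems(2)[of q] le[of q] qj by (auto simp: leD)
    have "?Y $ i $ q < ?Y $ i $ v" if "v \<notin> V - {j}" for v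
    proof (cases "v = j")
      case True then show ?thesis using q(2) by (simp add: le_less_trans[OF _ q(2)])
    next
      case False
      then have "?Z $ i $ j < ?Z $ i $ v" using that Cons.prems(2) by auto
      then show ?thesis using le[of v] \<open>?Y $ i $ q \<le> ?Z $ i $ j\<close> by (meson le_less_trans less_le_trans)
    qed
    from Cons.IH[OF qV this] obtain I where
      I: "finite I" "card I \<le> card (V - {j})" "calls X (nths cs I) $ i $ q \<le> ?Y $ i $ q" by blast
    let ?I = "insert 0 (Suc ` I)"
    have "{m. Suc m \<in> ?I} = I" by auto
    then have "calls X (nths (c # cs) ?I) = call_update k l a (calls X (nths cs I))"
      by (simp add: nths_Cons c)
    moreover have "call_update k l a (calls X (nths cs I)) $ i $ j \<le> calls X (nths cs I) $ i $ q + a"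
      using q(3) by (auto simp: call_update_def)
    moreover have "calls X (nths cs I) $ i $ q + a \<le> ?Y $ i $ q + a" using I(3) by (rule add_right_mono)
    ultimately have "calls X (nths (c # cs) ?I) $ i $ j \<le> ?Z $ i $ j"
      unfolding q(1) by (simp only: order_trans)
    moreover have "card (V - {j}) = card V - 1" "card V > 0"
      using Cons.prems(1) by (auto simp: card_gt_0_iff)
    ultimately show ?thesis using I(1,2)
      by (intro exI[of _ ?I]) (auto simp: card_insert_if card_image)
  qed
qed

text \<open>Each of the n^2 entries needs at most n calls, the size of the initial
  \<open>V = UNIV\<close>. The union of the position sets serves all entries at once, since further
  calls cannot raise an entry.\<close>

theorem bounded_number_of_calls:
  fixes X :: "ennreal ^ 'n::finite ^ 'n"
  shows "\<exists>ds. set ds \<subseteq> set cs \<and> length ds \<le> CARD('n) ^ 3 \<and> calls X ds = calls X cs"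
proof -
  have "\<exists>I. finite I \<and> card I \<le> CARD('n) \<and> calls X (nths cs I) $ i $ j \<le> calls X cs $ i $ j" for i j
    using few_calls_for_entry[of j UNIV X cs i] by auto
  then obtain I where I: "\<And>i j. finite (I i j)" "\<And>i j. card (I i j) \<le> CARD('n)"
    "\<And>i j. calls X (nths cs (I i j)) $ i $ j \<le> calls X cs $ i $ j" by metis
  define J where "J = (\<Union>(i, j)\<in>UNIV. I i j)"
  have fin: "finite J" by (auto simp: J_def I(1))
  have "card J \<le> (\<Sum>(i, j)\<in>UNIV. card (I i j))"
    unfolding J_def by (rule order_trans[OF card_UN_le]) (auto simp: case_prod_beta)
  also have "\<dots> \<le> (\<Sum>(i, j)\<in>(UNIV :: ('n \<times> 'n) set). CARD('n))"
    by (intro sum_mono) (auto simp: I(2))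
  also have "\<dots> = CARD('n) ^ 3" by (simp add: case_prod_beta power3_eq_cube)
  finally have card: "card J \<le> CARD('n) ^ 3" .
  have "length (nths cs J) \<le> card J"
    unfolding length_nths by (intro card_mono fin) auto
  moreover have "calls X (nths cs J) = calls X cs"
  proof -
    have "calls X (nths cs J) $ i $ j = calls X cs $ i $ j" for i j
    proof (rule antisym)
      have "calls X (nths cs J) $ i $ j \<le> calls X (nths cs (I i j)) $ i $ j"
        by (rule calls_nths_antimono) (auto simp: J_def)
      then show "calls X (nths cs J) $ i $ j \<le> calls X cs $ i $ j" using I(3) order_trans by blast
      show "calls X cs $ i $ j \<le> calls X (nths cs J) $ i $ j"
        using calls_nths_antimono[of J UNIV X cs i j] by (simp add: nths_all)
    qed
    then show ?thesis by (simp add: vec_eq_iff)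
  qed
  ultimately show ?thesis using card set_nths_subset[of cs J] by (intro exI[of _ "nths cs J"]) auto
qed

section \<open>The monoid is the closure of the products of metric matrices\<close>

text \<open>Compactness gives closedness in a Hausdorff space; separation passes from entries to
  vectors by preimages under a coordinate projection.\<close>

instance vec :: (t0_space, finite) t0_space
proof
  fix x y :: "'a ^ 'b"
  assume "x \<noteq> y"
  then obtain i where "x $ i \<noteq> y $ i" by (auto simp: vec_eq_iff)
  then obtain U where "open U" "\<not> (x $ i \<in> U \<longleftrightarrow> y $ i \<in> U)" using t0_space_class.t0_space by metis
  then show "\<exists>U. open U \<and> \<not> (x \<in> U \<longleftrightarrow> y \<in> U)"
    by (intro exI[of _ "(\<lambda>x. x $ i) -` U"]) (auto intro: open_vimage_vec_nth)
qed

instance vec :: (t1_space, finite) t1_space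
proof
  fix x y :: "'a ^ 'b"
  assume "x \<noteq> y"
  then obtain i where "x $ i \<noteq> y $ i" by (auto simp: vec_eq_iff)
  then obtain U where "open U" "x $ i \<in> U" "y $ i \<notin> U" using t1_space by metis
  then show "\<exists>U. open U \<and> x \<in> U \<and> y \<notin> U"
    by (intro exI[of _ "(\<lambda>x. x $ i) -` U"]) (auto intro: open_vimage_vec_nth)
qed

instance vec :: (t2_space, finite) t2_space
proof
  fix x y :: "'a ^ 'b"
  assume "x \<noteq> y"
  then obtain i where "x $ i \<noteq> y $ i" by (auto simp: vec_eq_iff)
  then obtain U V where "open U" "open V" "x $ i \<in> U" "y $ i \<in> V" "U \<inter> V = {}"
    using hausdorff by metis
  then show "\<exists>U V. open U \<and> open V \<and> x \<in> U \<and> y \<in> V \<and> U \<inter> V = {}"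
    by (intro exI[of _ "(\<lambda>x. x $ i) -` U"] exI[of _ "(\<lambda>x. x $ i) -` V"])
      (auto intro: open_vimage_vec_nth)
qed

text \<open>Fixing the pairs leaves only the losses to vary, and each call adds one compact factor
  \<open>UNIV\<close> of losses. This is where admitting the loss \<open>\<infinity>\<close>
  matters.\<close>

lemma compact_calls_along_word:
  fixes X :: "ennreal ^ 'n::finite ^ 'n"
  shows "compact {calls X cs |cs. map (\<lambda>c. (fst c, fst (snd c))) cs = w}"
proof (induction w)
  case Nil then show ?case by simp
next
  case (Cons p w)
  obtain k l where p: "p = (k, l)" by (cases p) auto
  let ?K = "{calls X cs |cs. map (\<lambda>c. (fst c, fst (snd c))) cs = w}"
  have "compact ((\<lambda>(Y, a). call_update k l a Y) ` (?K \<times> UNIV))"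
  proof (intro compact_continuous_image compact_Times compact_UNIV Cons)
    have "continuous_on A (\<lambda>z :: (ennreal ^ 'n ^ 'n) \<times> ennreal. fst z $ i $ j)" for A i j
      by (intro continuous_intros)
    then show "continuous_on (?K \<times> UNIV) (\<lambda>(Y, a). call_update k l a Y)"
      unfolding call_update_def case_prod_beta
      apply (intro continuous_on_vec_lambda)
      subgoal for i j
        by (cases "j = k"; cases "j = l") (simp_all add: continuous_intros)
      done
  qed
  moreover have "{calls X cs |cs. map (\<lambda>c. (fst c, fst (snd c))) cs = p # w}
      = (\<lambda>(Y, a). call_update k l a Y) ` (?K \<times> UNIV)"
  proof (intro equalityI subsetI)
    fix Z assume "Z \<in> (\<lambda>(Y, a). call_update k l a Y) ` (?K \<times> UNIV)"
    then obtain cs a where "Z = calls X ((k, l, a) # cs)" "map (\<lambda>c. (fst c, fst (snd c))) cs = w" by auto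
    then show "Z \<in> {calls X cs |cs. map (\<lambda>c. (fst c, fst (snd c))) cs = p # w}"
      by (auto simp: p intro!: exI[of _ "(k, l, a) # cs"])
  qed (fastforce simp: p map_eq_Cons_conv)
  ultimately show ?case by simp
qed

theorem closed_lossy_gossip_monoid: "closed (lossy_gossip_monoid :: (ennreal ^ 'n::finite ^ 'n) set)"
proof -
  let ?W = "{w :: ('n \<times> 'n) list. set w \<subseteq> {(k, l). k \<noteq> l} \<and> length w \<le> CARD('n) ^ 3}"
  let ?K = "\<lambda>w. {calls trop_one cs |cs. map (\<lambda>c. (fst c, fst (snd c))) cs = w}"
  have "(lossy_gossip_monoid :: (ennreal ^ 'n ^ 'n) set) = (\<Union>w\<in>?W. ?K w)"
  proof (intro equalityI subsetI)
    fix X :: "ennreal ^ 'n ^ 'n" assume "X \<in> lossy_gossip_monoid"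
    then obtain cs where cs: "X = calls trop_one cs" "proper_calls cs" unfolding lossy_gossip_monoid_eq by auto
    obtain ds where ds: "set ds \<subseteq> set cs" "length ds \<le> CARD('n) ^ 3" "calls trop_one ds = X"
      using bounded_number_of_calls[of cs trop_one] cs(1) by auto
    have "map (\<lambda>c. (fst c, fst (snd c))) ds \<in> ?W" using ds(1,2) cs(2) by auto
    then show "X \<in> (\<Union>w\<in>?W. ?K w)" using ds(3) by blast
  next
    fix X :: "ennreal ^ 'n ^ 'n" assume "X \<in> (\<Union>w\<in>?W. ?K w)"
    then show "X \<in> lossy_gossip_monoid" unfolding lossy_gossip_monoid_eq by fastforce
  qed
  moreover have "finite ?W" by (rule finite_lists_length_le) simp
  then have "closed (\<Union>w\<in>?W. ?K w :: (ennreal ^ 'n ^ 'n) set)"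
    by (intro compact_imp_closed compact_UN ballI compact_calls_along_word)
  ultimately show ?thesis by (simp only:)
qed

section \<open>A finite constant in place of infinity\<close>

text \<open>Real stand-in for \<open>trop_one\<close>, with \<open>b\<close> in the place of
  \<open>\<infinity>\<close>.\<close>

definition uniform_matrix :: "real \<Rightarrow> real ^ 'n ^ 'n" where
  "uniform_matrix b = (\<chi> i j. if i = j then 0 else b)"

lemma metric_products_base: "A \<in> metric_matrices \<Longrightarrow> A \<in> metric_products"
  unfolding metric_products_def by (auto intro!: exI[of _ A] exI[of _ "[]"])

lemma metric_products_mult:
  assumes "X \<in> metric_products" "A \<in> metric_matrices"
  shows "X \<odot> A \<in> metric_products"
proof -
  obtain Y As where "X = foldl (\<odot>) Y As" "Y \<in> metric_matrices" "set As \<subseteq> metric_matrices"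
    using assms(1) unfolding metric_products_def by auto
  then have "X \<odot> A = foldl (\<odot>) Y (As @ [A])" "set (As @ [A]) \<subseteq> metric_matrices" using assms(2) by auto
  then show ?thesis using \<open>Y \<in> metric_matrices\<close> unfolding metric_products_def by blast
qed

lemma metric_products_induct [consumes 1, case_names base mult]:
  assumes "X \<in> metric_products" "\<And>A. A \<in> metric_matrices \<Longrightarrow> P A"
    "\<And>X A. X \<in> metric_products \<Longrightarrow> P X \<Longrightarrow> A \<in> metric_matrices \<Longrightarrow> P (X \<odot> A)"
  shows "P X"
proof -
  obtain Y As where Y: "X = foldl (\<odot>) Y As" "Y \<in> metric_matrices" "set As \<subseteq> metric_matrices"
    using assms(1) unfolding metric_products_def by auto
  have "foldl (\<odot>) Y As \<in> metric_products \<and> P (foldl (\<odot>) Y As)" using Y(3)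
  proof (induction As rule: rev_induct)
    case Nil then show ?case using Y(2) assms(2) metric_products_base by auto
  next
    case (snoc A As) then show ?case using assms(3) metric_products_mult by auto
  qed
  then show ?thesis using Y(1) by simp
qed

lemma metric_products_nonneg:
  fixes X :: "real ^ 'n::finite ^ 'n"
  assumes "X \<in> metric_products"
  shows "0 \<le> X $ i $ j"
  using assms
proof (induction arbitrary: i j rule: metric_products_induct)
  case (base A) then show ?case by (simp add: metric_matrices_def)
next
  case (mult X A)
  obtain k where "(X \<odot> A) $ i $ j = X $ i $ k + A $ k $ j" using trop_mult_attained by blast
  then show ?case using mult by (simp add: metric_matrices_def)
qed

lemma uniform_matrix_metric: "0 \<le> b \<Longrightarrow> uniform_matrix b \<in> metric_matrices"
  by (auto simp: uniform_matrix_def metric_matrices_def)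

lemma metric_products_call_update:
  fixes X :: "real ^ 'n::finite ^ 'n"
  assumes "X \<in> metric_products" "0 \<le> a" "k \<noteq> l"
  shows "call_update k l a X \<in> metric_products"
proof -
  \<comment> \<open>\<open>M\<close> bounds \<open>a\<close> and every entry of \<open>X\<close>. In
    \<open>A\<close> below, a detour through a third point uses an edge of length \<open>M\<close>,
    which gives the triangle inequality; in the product such an edge never improves an entry of
    \<open>X\<close>.\<close>
  define M where "M = a + (\<Sum>i\<in>UNIV. \<Sum>j\<in>UNIV. X $ i $ j)"
  have nn: "0 \<le> X $ i $ j" for i j by (rule metric_products_nonneg[OF assms(1)])
  have "X $ i $ j \<le> (\<Sum>i\<in>UNIV. \<Sum>j\<in>UNIV. X $ i $ j)" for i j
    by (rule order_trans[OF member_le_sum[of j UNIV "\<lambda>j. X $ i $ j"]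
          member_le_sum[of i UNIV "\<lambda>i. \<Sum>j\<in>UNIV. X $ i $ j"]]) (auto simp: nn sum_nonneg)
  then have M: "X $ i $ j \<le> M" "a \<le> M" for i j using assms(2) nn by (auto simp: M_def sum_nonneg add_increasing)
  define A :: "real ^ 'n ^ 'n" where
    "A = (\<chi> i j. if i = j then 0 else if i = k \<and> j = l \<or> i = l \<and> j = k then a else M)"
  have "A \<in> metric_matrices"
    unfolding metric_matrices_def A_def using M assms(2) by auto
  moreover have "X \<odot> A = call_update k l a X"
  proof (rule trop_mult_eqI)
    show "call_update k l a X $ i $ j \<le> X $ i $ q + A $ q $ j" for i j q
    proof -
      have "call_update k l a X $ i $ j \<le> X $ i $ q + M"
        using order_trans[OF call_update_le M(1)] nn[of i q] by (smt (verit))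
      then show ?thesis using assms(3) by (auto simp: call_update_def A_def min_le_iff_disj)
    qed
    show "\<exists>q. X $ i $ q + A $ q $ j \<le> call_update k l a X $ i $ j" for i j
    proof -
      consider "j = k" "X $ i $ l + a < X $ i $ k" | "j = l" "X $ i $ k + a < X $ i $ l"
        | "call_update k l a X $ i $ j = X $ i $ j"
        using assms(3) unfolding call_update_def min_def vec_lambda_beta by (metis not_le)
      then show ?thesis
      proof cases
        case 1
        then show ?thesis using assms(3) by (intro exI[of _ l]) (simp add: call_update_def A_def)
      next
        case 2
        then show ?thesis using assms(3) by (intro exI[of _ k]) (simp add: call_update_def A_def)
      next
        case 3
        then show ?thesis by (intro exI[of _ j]) (simp add: A_def)
      qed
    qed
  qed
  ultimately show ?thesis using metric_products_mult[OF assms(1)] by metis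
qed

lemma calls_uniform_in_metric_products:
  fixes cs :: "('n::finite \<times> 'n \<times> real) list"
  assumes "0 \<le> b" "proper_calls cs" "\<forall>c\<in>set cs. 0 \<le> snd (snd c)"
  shows "calls (uniform_matrix b) cs \<in> metric_products"
  using assms(2,3)
  by (induction cs)
    (auto simp: metric_products_base uniform_matrix_metric assms(1) intro!: metric_products_call_update)

text \<open>Losses are nonnegative, so a path that starts with an off-diagonal \<open>b\<close>
  keeps weight at least \<open>b\<close>. An entry below \<open>b\<close> comes from a path without
  such a start and is the same when \<open>b\<close> is replaced by
  \<open>\<infinity>\<close>.\<close>

lemma calls_uniform_vs_trop_one:
  fixes cs :: "('n::finite \<times> 'n \<times> real) list"
  assumes "0 \<le> b" "\<forall>c\<in>set cs. 0 \<le> snd (snd c)"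
  defines "r \<equiv> calls (uniform_matrix b) cs"
    and "e \<equiv> calls trop_one (map (\<lambda>(k, l, a). (k, l, ennreal a)) cs)"
  shows "0 \<le> r $ i $ j \<and> ennreal (r $ i $ j) \<le> e $ i $ j
    \<and> (r $ i $ j < b \<longrightarrow> e $ i $ j = ennreal (r $ i $ j))"
  using assms(2) unfolding r_def e_def
proof (induction cs arbitrary: i j)
  case Nil
  then show ?case using assms(1) by (auto simp: uniform_matrix_def trop_one_def)
next
  case (Cons c cs)
  obtain k l a where c: "c = (k, l, a)" by (cases c) auto
  have a: "0 \<le> a" using Cons.prems c by simp
  let ?r = "calls (uniform_matrix b) cs"
  let ?e = "calls trop_one (map (\<lambda>(k, l, a). (k, l, ennreal a)) cs)"
  have IH: "0 \<le> ?r $ i $ j" "ennreal (?r $ i $ j) \<le> ?e $ i $ j"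
    "?r $ i $ j < b \<Longrightarrow> ?e $ i $ j = ennreal (?r $ i $ j)" for i j using Cons by auto
  have step: "0 \<le> min (?r $ i $ p) (?r $ i $ q + a) \<and>
      ennreal (min (?r $ i $ p) (?r $ i $ q + a)) \<le> min (?e $ i $ p) (?e $ i $ q + ennreal a) \<and>
      (min (?r $ i $ p) (?r $ i $ q + a) < b \<longrightarrow>
        min (?e $ i $ p) (?e $ i $ q + ennreal a) = ennreal (min (?r $ i $ p) (?r $ i $ q + a)))" for p q
  proof (intro conjI impI)
    show "0 \<le> min (?r $ i $ p) (?r $ i $ q + a)" using IH(1) a by simp
    have 1: "ennreal (min (?r $ i $ p) (?r $ i $ q + a)) = min (ennreal (?r $ i $ p)) (ennreal (?r $ i $ q) + ennreal a)"
      using IH(1) a by (simp add: min_def ennreal_le_iff flip: ennreal_plus)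
    have 2: "ennreal (?r $ i $ q) + ennreal a \<le> ?e $ i $ q + ennreal a" by (intro add_right_mono IH(2))
    show le: "ennreal (min (?r $ i $ p) (?r $ i $ q + a)) \<le> min (?e $ i $ p) (?e $ i $ q + ennreal a)"
      unfolding 1 by (intro min.mono IH(2) 2)
    assume lt: "min (?r $ i $ p) (?r $ i $ q + a) < b"
    show "min (?e $ i $ p) (?e $ i $ q + ennreal a) = ennreal (min (?r $ i $ p) (?r $ i $ q + a))"
    proof (cases "?r $ i $ p \<le> ?r $ i $ q + a")
      case True
      then have "?e $ i $ p = ennreal (min (?r $ i $ p) (?r $ i $ q + a))" using lt IH(3) by simp
      then show ?thesis using le by (simp add: antisym min.absorb1 min.coboundedI1)
    next
      case False
      then have "?e $ i $ q = ennreal (?r $ i $ q)" using lt IH(3)[of i q] a by simp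
      then have "?e $ i $ q + ennreal a = ennreal (min (?r $ i $ p) (?r $ i $ q + a))"
        using False IH(1) a by simp
      then show ?thesis using le by (simp add: antisym min.absorb2 min.coboundedI2)
    qed
  qed
  show ?case
    using step[of k l] step[of l k] IH[of i j] by (auto simp: c call_update_def)
qed

lemma calls_drop_infinite:
  fixes X :: "ennreal ^ 'n::finite ^ 'n"
  shows "calls X (filter (\<lambda>c. snd (snd c) \<noteq> \<infinity>) cs) = calls X cs"
proof (induction cs)
  case (Cons c cs)
  have "call_update k l \<infinity> Y = Y" for k l :: 'n and Y :: "ennreal ^ 'n ^ 'n"
    by (simp add: call_update_def vec_eq_iff)
  with Cons show ?case by auto
qed simp

text \<open>Calls with infinite loss change nothing and are dropped, which leaves real
  losses.\<close>

lemma lossy_gossip_monoid_finite_calls: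
  fixes X :: "ennreal ^ 'n::finite ^ 'n"
  assumes "X \<in> lossy_gossip_monoid"
  shows "\<exists>cs :: ('n \<times> 'n \<times> real) list. proper_calls cs \<and> (\<forall>c\<in>set cs. 0 \<le> snd (snd c)) \<and>
    length cs \<le> CARD('n) ^ 3 \<and> X = calls trop_one (map (\<lambda>(k, l, a). (k, l, ennreal a)) cs)"
proof -
  obtain ds where ds: "X = calls trop_one ds" "proper_calls ds"
    using assms unfolding lossy_gossip_monoid_eq by auto
  obtain es where es: "set es \<subseteq> set ds" "length es \<le> CARD('n) ^ 3" "calls trop_one es = X"
    using bounded_number_of_calls[of ds trop_one] ds(1) by auto
  let ?fs = "filter (\<lambda>c. snd (snd c) \<noteq> \<infinity>) es"
  let ?cs = "map (\<lambda>(k, l, a). (k, l, enn2real a)) ?fs"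
  have "map (\<lambda>(k, l, a). (k, l, ennreal a)) ?cs = ?fs"
    by (simp add: case_prod_beta o_def) (rule map_idI, simp add: less_top[symmetric])
  then have "X = calls trop_one (map (\<lambda>(k, l, a). (k, l, ennreal a)) ?cs)"
    using calls_drop_infinite es(3) by metis
  moreover have "length ?cs \<le> CARD('n) ^ 3"
    using es(2) by (simp add: order_trans[OF length_filter_le])
  moreover have "proper_calls ?cs" using ds(2) es(1) by fastforce
  moreover have "\<forall>c\<in>set ?cs. 0 \<le> snd (snd c)" by auto
  ultimately show ?thesis by (intro exI[of _ ?cs]) blast
qed

text \<open>Call every pair with loss \<open>A $ k $ l\<close>, in any order. No stage falls below
  the product, because the triangle inequality makes the product stable under these calls; and the
  call \<open>(k, l)\<close> alone brings column \<open>l\<close> down to what passing through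
  \<open>k\<close> gives.\<close>

lemma trop_mult_metric_as_calls:
  fixes X :: "ennreal ^ 'n::finite ^ 'n" and A :: "real ^ 'n ^ 'n"
  assumes "A \<in> metric_matrices"
  shows "\<exists>cs. proper_calls cs \<and> X \<odot> ennreal_matrix A = calls X cs"
proof -
  obtain ps :: "('n \<times> 'n) list" where ps: "set ps = {(k, l). k \<noteq> l}"
    using finite_list[of "{(k, l). k \<noteq> (l::'n)}"] by auto
  let ?A = "ennreal_matrix A"
  have A: "?A $ i $ i = 0" "?A $ i $ j = ?A $ j $ i" "?A $ i $ k \<le> ?A $ i $ j + ?A $ j $ k" for i j k
    using assms by (auto simp: metric_matrices_def ennreal_matrix_def ennreal_leI simp flip: ennreal_plus)
  define calls_of where "calls_of = map (\<lambda>(k, l). (k, l, ?A $ k $ l))"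
  have lower: "(X \<odot> ?A) $ i $ j \<le> calls X (calls_of qs) $ i $ j" for qs i j
  proof (induction qs arbitrary: i j)
    case Nil
    show ?case using trop_mult_le[of X ?A i j j] by (simp add: calls_of_def A(1))
  next
    case (Cons p qs)
    obtain k l where p: "p = (k, l)" by (cases p)
    let ?Z = "calls X (calls_of qs)"
    have "(X \<odot> ?A) $ i $ s \<le> ?Z $ i $ t + ?A $ t $ s" for s t
    proof -
      obtain q where "(X \<odot> ?A) $ i $ t = X $ i $ q + ?A $ q $ t" using trop_mult_attained by blast
      then have "X $ i $ q + ?A $ q $ t \<le> ?Z $ i $ t" using Cons by metis
      have "X $ i $ q + ?A $ q $ s \<le> X $ i $ q + (?A $ q $ t + ?A $ t $ s)"
        by (intro add_left_mono A(3))
      then have "(X \<odot> ?A) $ i $ s \<le> (X $ i $ q + ?A $ q $ t) + ?A $ t $ s"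
        unfolding add.assoc by (rule order_trans[OF trop_mult_le])
      also have "\<dots> \<le> ?Z $ i $ t + ?A $ t $ s"
        by (intro add_right_mono \<open>X $ i $ q + ?A $ q $ t \<le> ?Z $ i $ t\<close>)
      finally show ?thesis .
    qed
    from this[of k l] this[of l k] show ?case
      using Cons A(2)[of k l] by (auto simp: calls_of_def p call_update_def)
  qed
  have upper: "calls X (calls_of qs) $ i $ l \<le> X $ i $ k + ?A $ k $ l" if "(k, l) \<in> set qs" for qs i k l
    using that
  proof (induction qs)
    case (Cons p qs)
    let ?Z = "calls X (calls_of qs)"
    show ?case
    proof (cases "p = (k, l)")
      case True
      have "call_update k l (?A $ k $ l) ?Z $ i $ l \<le> ?Z $ i $ k + ?A $ k $ l"
        by (auto simp: call_update_def)
      also have "\<dots> \<le> X $ i $ k + ?A $ k $ l" by (intro add_right_mono calls_le)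
      finally show ?thesis by (simp add: calls_of_def True)
    next
      case False
      then have "?Z $ i $ l \<le> X $ i $ k + ?A $ k $ l" using Cons by auto
      then show ?thesis
        using order_trans[OF call_update_le] by (auto simp: calls_of_def case_prod_beta)
    qed
  qed simp
  have "X \<odot> ?A = calls X (calls_of ps)"
  proof (rule trop_mult_eqI)
    show "calls X (calls_of ps) $ i $ j \<le> X $ i $ k + ?A $ k $ j" for i j k
    proof (cases "k = j")
      case True then show ?thesis using calls_le[of X "calls_of ps" i j] by (simp add: A(1))
    next
      case False then show ?thesis using upper ps by simp
    qed
    show "\<exists>k. X $ i $ k + ?A $ k $ j \<le> calls X (calls_of ps) $ i $ j" for i j
      using lower[of i j ps] trop_mult_attained[of X ?A i j] by metis
  qed
  moreover have "proper_calls (calls_of ps)" using ps by (auto simp: calls_of_def)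
  ultimately show ?thesis by blast
qed

lemma ennreal_matrix_trop_mult:
  fixes X A :: "real ^ 'n::finite ^ 'n"
  assumes "\<And>i j. 0 \<le> X $ i $ j" "\<And>i j. 0 \<le> A $ i $ j"
  shows "ennreal_matrix (X \<odot> A) = ennreal_matrix X \<odot> ennreal_matrix A"
proof (rule sym, rule trop_mult_eqI)
  show "ennreal_matrix (X \<odot> A) $ i $ j \<le> ennreal_matrix X $ i $ k + ennreal_matrix A $ k $ j" for i j k
    using assms trop_mult_le[of X A i j k] by (simp add: ennreal_matrix_def ennreal_leI flip: ennreal_plus)
  show "\<exists>k. ennreal_matrix X $ i $ k + ennreal_matrix A $ k $ j \<le> ennreal_matrix (X \<odot> A) $ i $ j" for i j
  proof -
    obtain k where "(X \<odot> A) $ i $ j = X $ i $ k + A $ k $ j" using trop_mult_attained by blast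
    then show ?thesis using assms by (intro exI[of _ k]) (simp add: ennreal_matrix_def)
  qed
qed

lemma metric_products_in_lossy_gossip_monoid:
  assumes "X \<in> metric_products"
  shows "ennreal_matrix X \<in> lossy_gossip_monoid"
  using assms
proof (induction rule: metric_products_induct)
  case (base A)
  then show ?case using trop_mult_metric_as_calls[of A trop_one] unfolding lossy_gossip_monoid_eq by auto
next
  case (mult X A)
  obtain cs where cs: "ennreal_matrix X = calls trop_one cs" "proper_calls cs"
    using mult.IH unfolding lossy_gossip_monoid_eq by auto
  obtain ds where ds: "ennreal_matrix X \<odot> ennreal_matrix A = calls (ennreal_matrix X) ds" "proper_calls ds"
    using trop_mult_metric_as_calls mult.hyps(2) by blast
  have "ennreal_matrix (X \<odot> A) = calls trop_one (ds @ cs)"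
    using cs ds mult.hyps
    by (simp add: ennreal_matrix_trop_mult metric_products_nonneg metric_matrices_def calls_append)
  moreover have "proper_calls (ds @ cs)" using cs ds by auto
  ultimately show ?case unfolding lossy_gossip_monoid_eq by blast
qed

text \<open>The comparison with \<open>trop_one\<close> is applied twice: it first bounds the result
  by \<open>X\<close>, hence below \<open>b\<close>, and then gives equality.\<close>

lemma calls_uniform_eq:
  fixes X :: "real ^ 'n::finite ^ 'n"
  assumes "\<forall>c\<in>set cs. 0 \<le> snd (snd c)"
    "ennreal_matrix X = calls trop_one (map (\<lambda>(k, l, a). (k, l, ennreal a)) cs)"
    "\<And>i j. 0 \<le> X $ i $ j" "\<And>i j. X $ i $ j < b" "0 \<le> b"
  shows "calls (uniform_matrix b) cs = X"
proof -
  have "calls (uniform_matrix b) cs $ i $ j = X $ i $ j" for i j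
  proof -
    let ?r = "calls (uniform_matrix b) cs $ i $ j"
    have *: "0 \<le> ?r" "ennreal ?r \<le> ennreal (X $ i $ j)" "?r < b \<longrightarrow> ennreal (X $ i $ j) = ennreal ?r"
      using calls_uniform_vs_trop_one[OF assms(5,1), of i j] unfolding assms(2)[symmetric]
      by (auto simp: ennreal_matrix_def)
    then have "?r \<le> X $ i $ j" using assms(3) by (simp add: ennreal_le_iff)
    then have "?r < b" using assms(4)[of i j] by simp
    with * show ?thesis using assms(3)[of i j] by simp
  qed
  then show ?thesis by (simp add: vec_eq_iff)
qed

theorem metric_products_eq_finite_part:
  "(metric_products :: (real ^ 'n::finite ^ 'n) set)
    = {X. (\<forall>i j. 0 \<le> X $ i $ j) \<and> ennreal_matrix X \<in> lossy_gossip_monoid}"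
proof (intro equalityI subsetI)
  fix X :: "real ^ 'n ^ 'n"
  assume "X \<in> {X. (\<forall>i j. 0 \<le> X $ i $ j) \<and> ennreal_matrix X \<in> lossy_gossip_monoid}"
  then have X: "\<And>i j. 0 \<le> X $ i $ j" "ennreal_matrix X \<in> lossy_gossip_monoid" by auto
  obtain cs where cs: "proper_calls cs" "\<forall>c\<in>set cs. 0 \<le> snd (snd c)"
    "ennreal_matrix X = calls trop_one (map (\<lambda>(k, l, a). (k, l, ennreal a)) cs)"
    using lossy_gossip_monoid_finite_calls[OF X(2)] by auto
  obtain b where b: "\<And>i j. X $ i $ j < b"
  proof
    show "X $ i $ j < 1 + norm X" for i j
      using component_le_norm_cart[of "X $ i" j] Finite_Cartesian_Product.norm_nth_le[of X i] by (smt (verit))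
  qed
  have "0 \<le> b" using X(1) b by (meson less_imp_le order_trans)
  show "X \<in> metric_products"
    using calls_uniform_in_metric_products[OF \<open>0 \<le> b\<close> cs(1,2)]
      calls_uniform_eq[OF cs(2,3) X(1) b \<open>0 \<le> b\<close>] by simp
qed (auto simp: metric_products_nonneg metric_products_in_lossy_gossip_monoid)

text \<open>The cones of the fan are closures of sign classes, so the set must contain its limits.
  It is a preimage of the closed monoid under a continuous map, cut by closed half-spaces.\<close>

theorem closed_metric_products: "closed (metric_products :: (real ^ 'n::finite ^ 'n) set)"
proof -
  have "continuous_on UNIV (ennreal_matrix :: real ^ 'n ^ 'n \<Rightarrow> _)"
    unfolding ennreal_matrix_def
    by (intro continuous_on_vec_lambda continuous_on_ennreal continuous_intros)
  then have "closed (ennreal_matrix -` lossy_gossip_monoid :: (real ^ 'n ^ 'n) set)"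
    using closed_lossy_gossip_monoid continuous_on_closed_vimage[of UNIV] by auto
  moreover have "closed {X :: real ^ 'n ^ 'n. \<forall>i j. 0 \<le> X $ i $ j}"
    by (intro closed_Collect_all closed_Collect_le continuous_intros)
  moreover have "(metric_products :: (real ^ 'n ^ 'n) set)
      = {X. \<forall>i j. 0 \<le> X $ i $ j} \<inter> ennreal_matrix -` lossy_gossip_monoid"
    unfolding metric_products_eq_finite_part by auto
  ultimately show ?thesis by (metis closed_Int)
qed

theorem closure_metric_products:
  "closure (ennreal_matrix ` metric_products) = (lossy_gossip_monoid :: (ennreal ^ 'n::finite ^ 'n) set)"
proof
  show "closure (ennreal_matrix ` metric_products) \<subseteq> (lossy_gossip_monoid :: (ennreal ^ 'n ^ 'n) set)"
    by (intro closure_minimal closed_lossy_gossip_monoid)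
      (auto simp: metric_products_in_lossy_gossip_monoid)
  show "(lossy_gossip_monoid :: (ennreal ^ 'n ^ 'n) set) \<subseteq> closure (ennreal_matrix ` metric_products)"
  proof
    fix X :: "ennreal ^ 'n ^ 'n" assume "X \<in> lossy_gossip_monoid"
    from lossy_gossip_monoid_finite_calls[OF this] obtain cs where cs: "proper_calls cs"
      "\<forall>c\<in>set cs. 0 \<le> snd (snd c)" "X = calls trop_one (map (\<lambda>(k, l, a). (k, l, ennreal a)) cs)"
      by auto
    \<comment> \<open>Truncation at level \<open>m\<close>: the start matrix has \<open>m\<close>
      for \<open>\<infinity>\<close>, and each entry is squeezed between the minimum of
      \<open>m\<close> and the entry of \<open>X\<close>, and that entry itself.\<close>
    define r where "r = (\<lambda>m. calls (uniform_matrix (real m)) cs)"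
    have r: "ennreal (r m $ i $ j) \<le> X $ i $ j" "min (ennreal m) (X $ i $ j) \<le> ennreal (r m $ i $ j)" for m i j
    proof -
      have *: "ennreal (r m $ i $ j) \<le> X $ i $ j" "r m $ i $ j < real m \<longrightarrow> X $ i $ j = ennreal (r m $ i $ j)"
        using calls_uniform_vs_trop_one[of "real m" cs i j] cs(2,3) by (auto simp: r_def)
      show "ennreal (r m $ i $ j) \<le> X $ i $ j" by (rule *)
      show "min (ennreal m) (X $ i $ j) \<le> ennreal (r m $ i $ j)"
        using * by (cases "r m $ i $ j < real m") (auto simp: min_le_iff_disj not_less ennreal_leI)
    qed
    have "(\<lambda>m. ennreal_matrix (r m)) \<longlonglongrightarrow> X"
    proof (intro vec_tendstoI)
      fix i j
      have "(\<lambda>m. min (ennreal (real m)) (X $ i $ j)) \<longlonglongrightarrow> min top (X $ i $ j)"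
        unfolding ennreal_of_nat_eq_real_of_nat[symmetric]
        by (intro tendsto_min of_nat_tendsto_top_ennreal tendsto_const)
      then have "(\<lambda>m. min (ennreal (real m)) (X $ i $ j)) \<longlonglongrightarrow> X $ i $ j" by simp
      then have "(\<lambda>m. ennreal (r m $ i $ j)) \<longlonglongrightarrow> X $ i $ j"
        by (rule tendsto_sandwich[OF always_eventually[OF allI[OF r(2)]]
              always_eventually[OF allI[OF r(1)]] _ tendsto_const])
      then show "(\<lambda>m. ennreal_matrix (r m) $ i $ j) \<longlonglongrightarrow> X $ i $ j" by (simp add: ennreal_matrix_def)
    qed
    moreover have "ennreal_matrix (r m) \<in> ennreal_matrix ` metric_products" for m
      unfolding r_def by (intro imageI calls_uniform_in_metric_products cs) simp
    ultimately show "X \<in> closure (ennreal_matrix ` metric_products)"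
      by (intro Lim_in_closed_set[OF closed_closure always_eventually sequentially_bot])
        (auto intro: subsetD[OF closure_subset])
  qed
qed

section \<open>Fans of sign classes\<close>

lemma real_between_finite_sets:
  fixes L U :: "real set"
  assumes "finite L" "finite U" "\<And>x y. x \<in> L \<Longrightarrow> y \<in> U \<Longrightarrow> x < y"
  shows "\<exists>s. (\<forall>x\<in>L. x < s) \<and> (\<forall>y\<in>U. s < y)"
proof (cases "L = {}")
  case True
  show ?thesis
  proof (cases "U = {}")
    case False
    have "Min U - 1 < y" if "y \<in> U" for y using Min_le[OF assms(2) that] by simp
    then show ?thesis using True by blast
  qed (use True in auto)
next
  case L: False
  show ?thesis
  proof (cases "U = {}")
    case True
    have "x < Max L + 1" if "x \<in> L" for x using Max_ge[OF assms(1) that] by simp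
    then show ?thesis using True by blast
  next
    case False
    have "Max L < Min U" using assms L False by simp
    then obtain s where "Max L < s" "s < Min U" using dense by blast
    then show ?thesis using assms L False by auto
  qed
qed

text \<open>The hypothesis says that \<open>f\<close> and \<open>g\<close> order \<open>I\<close>
  alike, ties included. If \<open>t\<close> is some \<open>f i\<close>, take \<open>g i\<close>;
  otherwise \<open>t\<close> lies in a gap, and the corresponding gap of \<open>g\<close> is
  nonempty by density.\<close>

lemma transfer_position:
  fixes f g :: "'i \<Rightarrow> real"
  assumes "finite I" "\<And>i j. i \<in> I \<Longrightarrow> j \<in> I \<Longrightarrow> sgn (f i - f j) = sgn (g i - g j)"
  shows "\<exists>s. \<forall>i\<in>I. sgn (t - f i) = sgn (s - g i)"
proof (cases "\<exists>i\<in>I. t = f i")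
  case True
  then show ?thesis using assms(2) by blast
next
  case False
  have lt: "g i < g j" if "i \<in> {i\<in>I. f i < t}" "j \<in> {i\<in>I. t < f i}" for i j
  proof -
    have "sgn (f j - f i) = 1" "i \<in> I" "j \<in> I" using that by auto
    then have "sgn (g j - g i) = 1" using assms(2)[of j i] by simp
    then show ?thesis by (simp add: sgn_1_pos)
  qed
  have "\<exists>s. (\<forall>x\<in>g ` {i\<in>I. f i < t}. x < s) \<and> (\<forall>y\<in>g ` {i\<in>I. t < f i}. s < y)"
    by (rule real_between_finite_sets) (use assms(1) lt in auto)
  then obtain s where s: "\<forall>x\<in>g ` {i\<in>I. f i < t}. x < s" "\<forall>y\<in>g ` {i\<in>I. t < f i}. s < y"
    by blast
  have "sgn (t - f i) = sgn (s - g i)" if "i \<in> I" for i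
  proof (cases "f i < t")
    case True then show ?thesis using s(1) that by simp
  next
    case F: False
    then have "t < f i" using False that by (metis linorder_less_linear)
    then show ?thesis using s(2) that by simp
  qed
  then show ?thesis by blast
qed

text \<open>The vector \<open>x\<close> is kept apart because only the parameters are eliminated.
  Parameters are indexed by \<open>nat\<close> with a bound \<open>K\<close>, so elimination lowers
  \<open>K\<close> without a change of type.\<close>

definition affine_form :: "nat \<Rightarrow> 'v::real_inner \<times> (nat \<Rightarrow> real) \<Rightarrow> 'v \<Rightarrow> (nat \<Rightarrow> real) \<Rightarrow> real" where
  "affine_form K f x \<theta> = fst f \<bullet> x + (\<Sum>r<K. snd f r * \<theta> r)"

text \<open>One implication suffices, as equality of signs is symmetric: \<open>P\<close> is a union
  of sign classes of \<open>A\<close>.\<close>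

definition sign_determined ::
    "nat \<Rightarrow> ('v::real_inner \<times> (nat \<Rightarrow> real)) set \<Rightarrow> ('v \<Rightarrow> (nat \<Rightarrow> real) \<Rightarrow> bool) \<Rightarrow> bool" where
  "sign_determined K A P \<longleftrightarrow> (\<forall>x \<theta> y \<eta>.
     (\<forall>f\<in>A. sgn (affine_form K f x \<theta>) = sgn (affine_form K f y \<eta>)) \<longrightarrow> P x \<theta> \<longrightarrow> P y \<eta>)"

text \<open>One step of Fourier-Motzkin elimination: the order of the values of \<open>t\<close> at which the forms
  change sign determines which sign patterns occur along the fibre.\<close>

lemma sign_determined_eliminate:
  fixes A :: "('v::real_inner \<times> (nat \<Rightarrow> real)) set"
  assumes "finite A" "sign_determined (Suc K) A P"
  shows "\<exists>A'. finite A' \<and> sign_determined K A' (\<lambda>x \<theta>. \<exists>t. P x (\<theta>(K := t)))"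
proof (intro exI conjI)
  \<comment> \<open>The value of \<open>d f g\<close> is the root of \<open>g\<close> minus the root
    of \<open>f\<close> in variable \<open>K\<close>. For a zero coefficient at \<open>K\<close>,
    division gives the dummy root \<open>0\<close>; such forms are compared directly, for which
    \<open>A\<close> is kept inside \<open>A'\<close>.\<close>
  define d :: "'v \<times> (nat \<Rightarrow> real) \<Rightarrow> 'v \<times> (nat \<Rightarrow> real) \<Rightarrow> 'v \<times> (nat \<Rightarrow> real)" where
    "d f g = (fst f /\<^sub>R snd f K - fst g /\<^sub>R snd g K, \<lambda>r. snd f r / snd f K - snd g r / snd g K)" for f g
  define A' where "A' = A \<union> (\<lambda>(f, g). d f g) ` (A \<times> A)"
  show "finite A'" using assms(1) by (simp add: A'_def)
  have af_d: "affine_form K (d f g) x \<theta> = affine_form K f x \<theta> / snd f K - affine_form K g x \<theta> / snd g K"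
    for f g x \<theta>
  proof -
    have "(\<Sum>r<K. (snd f r / snd f K - snd g r / snd g K) * \<theta> r)
        = (\<Sum>r<K. snd f r * \<theta> r) / snd f K - (\<Sum>r<K. snd g r * \<theta> r) / snd g K"
      unfolding sum_divide_distrib sum_subtractf[symmetric]
      by (intro sum.cong) (auto simp: left_diff_distrib)
    then show ?thesis
      by (simp add: affine_form_def d_def inner_diff_left add_divide_distrib)
        (simp add: divide_inverse_commute)
  qed
  have af_Suc: "affine_form (Suc K) f x (\<theta>(K := t)) = affine_form K f x \<theta> + snd f K * t" for f x \<theta> t
    by (simp add: affine_form_def)
  show "sign_determined K A' (\<lambda>x \<theta>. \<exists>t. P x (\<theta>(K := t)))"
    unfolding sign_determined_def
  proof (intro allI impI)
    fix x \<theta> y \<eta>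
    assume eq: "\<forall>f\<in>A'. sgn (affine_form K f x \<theta>) = sgn (affine_form K f y \<eta>)"
    assume "\<exists>t. P x (\<theta>(K := t))"
    then obtain t where t: "P x (\<theta>(K := t))" by blast
    define root where "root z \<zeta> f = - (affine_form K f z \<zeta> / snd f K)" for z \<zeta> and f :: "'v \<times> (nat \<Rightarrow> real)"
    have "sgn (root x \<theta> f - root x \<theta> g) = sgn (root y \<eta> f - root y \<eta> g)" if "f \<in> A" "g \<in> A" for f g
    proof -
      have "d g f \<in> A'" using that by (auto simp: A'_def)
      with eq have "sgn (affine_form K (d g f) x \<theta>) = sgn (affine_form K (d g f) y \<eta>)" by blast
      then show ?thesis by (simp add: af_d root_def algebra_simps)
    qed
    from transfer_position[of A "root x \<theta>" "root y \<eta>" t, OF assms(1) this] obtain s where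
      s: "\<And>f. f \<in> A \<Longrightarrow> sgn (t - root x \<theta> f) = sgn (s - root y \<eta> f)" by blast
    have "sgn (affine_form (Suc K) f x (\<theta>(K := t))) = sgn (affine_form (Suc K) f y (\<eta>(K := s)))" if "f \<in> A" for f
    proof (cases "snd f K = 0")
      case True
      then show ?thesis using eq that by (simp add: af_Suc A'_def)
    next
      case False
      have "affine_form K f z \<zeta> + snd f K * u = snd f K * (u - root z \<zeta> f)" for z \<zeta> u
        using False by (simp add: root_def field_simps)
      then show ?thesis using s[OF that] by (simp add: af_Suc sgn_mult)
    qed
    then have "P y (\<eta>(K := s))" using assms(2) t unfolding sign_determined_def by blast
    then show "\<exists>t. P y (\<eta>(K := t))" by blast
  qed
qed

theorem sign_determined_projection:
  fixes A :: "('v::real_inner \<times> (nat \<Rightarrow> real)) set"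
  assumes "finite A" "sign_determined K A P"
  shows "\<exists>B. finite B \<and> (\<forall>x y. (\<forall>a\<in>B. sgn (a \<bullet> x) = sgn (a \<bullet> y)) \<longrightarrow> (\<exists>\<theta>. P x \<theta>) \<longrightarrow> (\<exists>\<theta>. P y \<theta>))"
  using assms
proof (induction K arbitrary: A P)
  case 0
  show ?case
  proof (intro exI[of _ "fst ` A"] conjI allI impI)
    show "finite (fst ` A)" using 0 by simp
    fix x y assume "\<forall>a\<in>fst ` A. sgn (a \<bullet> x) = sgn (a \<bullet> y)" "\<exists>\<theta>. P x \<theta>"
    then show "\<exists>\<theta>. P y \<theta>" using 0(2) unfolding sign_determined_def affine_form_def by auto
  qed
next
  case (Suc K)
  obtain A' where A': "finite A'" "sign_determined K A' (\<lambda>x \<theta>. \<exists>t. P x (\<theta>(K := t)))"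
    using sign_determined_eliminate[OF Suc.prems] by blast
  have "(\<exists>\<theta> t. P x (\<theta>(K := t))) \<longleftrightarrow> (\<exists>\<theta>. P x \<theta>)" for x by (metis fun_upd_triv)
  then show ?case using Suc.IH[OF A'] by (simp only:)
qed

section \<open>Closed cells, their faces and their dimension\<close>

text \<open>This is the closure of the sign class of \<open>x\<close>: strict signs become weak,
  while \<open>a \<bullet> x = 0\<close> triggers both implications and forces
  \<open>a \<bullet> y = 0\<close>.\<close>

definition cell :: "'v::real_inner set \<Rightarrow> 'v \<Rightarrow> 'v set" where
  "cell A x = {y. \<forall>a\<in>A. (a \<bullet> x \<le> 0 \<longrightarrow> a \<bullet> y \<le> 0) \<and> (a \<bullet> x \<ge> 0 \<longrightarrow> a \<bullet> y \<ge> 0)}"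

lemma cell_self: "x \<in> cell A x"
  by (simp add: cell_def)

lemma cell_same_signs:
  assumes "z \<in> cell A x" "\<And>a. a \<in> A \<Longrightarrow> sgn (a \<bullet> w) = sgn (a \<bullet> z)"
  shows "w \<in> cell A x"
proof -
  have "(a \<bullet> w \<le> 0 \<longleftrightarrow> a \<bullet> z \<le> 0) \<and> (0 \<le> a \<bullet> w \<longleftrightarrow> 0 \<le> a \<bullet> z)" if "a \<in> A" for a
    using assms(2)[OF that] by (auto simp: sgn_if split: if_splits)
  then show ?thesis using assms(1) by (simp add: cell_def)
qed

lemma polyhedral_cone_cell:
  fixes x :: "'v::euclidean_space"
  assumes "finite A"
  shows "polyhedral_cone (cell A x)"
proof -
  define H where "H a = (if a \<bullet> x \<le> 0 then {y. a \<bullet> y \<le> 0} else UNIV) \<inter>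
    (if a \<bullet> x \<ge> 0 then {y. a \<bullet> y \<ge> 0} else UNIV)" for a
  have "polyhedron (\<Inter>(H ` A))"
    by (intro polyhedron_Inter) (auto simp: assms H_def
          intro!: polyhedron_Int polyhedron_halfspace_le polyhedron_halfspace_ge[where b = 0, simplified])
  moreover have "cell A x = \<Inter>(H ` A)" by (fastforce simp: cell_def H_def split: if_splits)
  moreover have "cone (cell A x)"
    unfolding cone_def cell_def by (auto simp: mult_nonneg_nonpos mult_nonneg_nonneg)
  ultimately show ?thesis using cell_self[of x A] by (auto simp: polyhedral_cone_def)
qed

text \<open>A form has at \<open>y\<close> weakly the sign it has at \<open>x\<close>, so any
  positive share of \<open>x\<close> restores the exact sign. Thus every point of a cell is a limit
  of points with the signs of \<open>x\<close>.\<close>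

lemma cell_combination_same_signs:
  assumes "y \<in> cell A x" "a \<in> A" "0 < e" "e \<le> 1"
  shows "sgn (a \<bullet> ((1 - e) *\<^sub>R y + e *\<^sub>R x)) = sgn (a \<bullet> x)"
proof -
  have *: "a \<bullet> x \<le> 0 \<Longrightarrow> a \<bullet> y \<le> 0" "a \<bullet> x \<ge> 0 \<Longrightarrow> a \<bullet> y \<ge> 0" using assms by (auto simp: cell_def)
  consider "a \<bullet> x = 0" | "a \<bullet> x > 0" | "a \<bullet> x < 0" by linarith
  then show ?thesis
  proof cases
    case 1 then show ?thesis using * by (simp add: inner_add_right)
  next
    case 2
    then have "(1 - e) * (a \<bullet> y) + e * (a \<bullet> x) > 0" using * assms by (intro add_nonneg_pos) auto
    then show ?thesis using 2 by (simp add: inner_add_right)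
  next
    case 3
    then have "(1 - e) * (a \<bullet> y) + e * (a \<bullet> x) < 0"
      using * assms by (intro add_nonpos_neg) (auto simp: mult_nonneg_nonpos mult_pos_neg)
    then show ?thesis using 3 by (simp add: inner_add_right)
  qed
qed

lemma cell_subset:
  fixes S :: "'v::euclidean_space set"
  assumes "closed S" "\<And>x y. x \<in> S \<Longrightarrow> (\<forall>a\<in>A. sgn (a \<bullet> x) = sgn (a \<bullet> y)) \<Longrightarrow> y \<in> S" "x \<in> S"
  shows "cell A x \<subseteq> S"
proof
  fix y assume y: "y \<in> cell A x"
  define z where "z n = (1 - 1 / real (Suc n)) *\<^sub>R y + (1 / real (Suc n)) *\<^sub>R x" for n
  have "z n \<in> S" for n
    using assms(2)[OF assms(3)] cell_combination_same_signs[OF y, of _ "1 / real (Suc n)"] by (simp add: z_def)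
  moreover have "z \<longlonglongrightarrow> (1 - 0) *\<^sub>R y + 0 *\<^sub>R x"
    unfolding z_def using LIMSEQ_inverse_real_of_nat
    by (intro tendsto_intros) (simp_all add: inverse_eq_divide)
  ultimately show "y \<in> S" using assms(1) by (auto intro: closed_sequentially)
qed

lemma eventually_keeps_sign:
  fixes a x v :: "'v::real_inner"
  assumes "a \<bullet> x \<noteq> 0"
  shows "\<forall>\<^sub>F e in at_right 0. sgn (a \<bullet> (x + e *\<^sub>R v)) = sgn (a \<bullet> x)"
proof -
  have lim: "((\<lambda>e. a \<bullet> (x + e *\<^sub>R v)) \<longlongrightarrow> a \<bullet> (x + 0 *\<^sub>R v)) (at_right 0)"
    by (intro tendsto_intros)
  show ?thesis
  proof (cases "a \<bullet> x > 0")
    case True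
    then show ?thesis using order_tendstoD(1)[OF lim, of 0] by (auto elim: eventually_mono)
  next
    case False
    then show ?thesis using order_tendstoD(2)[OF lim, of 0] assms by (auto elim: eventually_mono)
  qed
qed

text \<open>Take \<open>z\<close> in the relative interior of \<open>T\<close>. Segments of
  \<open>T\<close> extend beyond \<open>z\<close>, so a form vanishing at \<open>z\<close>, having
  one weak sign on \<open>cell A x\<close>, vanishes on \<open>T\<close>. Conversely, the segment
  from \<open>y\<close> in \<open>cell A z\<close> through \<open>z\<close> extends a little inside
  \<open>cell A x\<close>, and the face property pulls \<open>y\<close> into
  \<open>T\<close>.\<close>

lemma cell_face_is_cell:
  fixes x :: "'v::euclidean_space"
  assumes "finite A" "T face_of cell A x" "T \<noteq> {}"
  shows "\<exists>z\<in>T. T = cell A z"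
proof -
  have conv: "convex T" using assms(2) face_of_imp_convex by blast
  have sub: "T \<subseteq> cell A x" using assms(2) face_of_imp_subset by blast
  obtain z where z: "z \<in> rel_interior T" using conv assms(3) rel_interior_eq_empty by blast
  then have zT: "z \<in> T" using rel_interior_subset by blast
  have zx: "(a \<bullet> x \<le> 0 \<longrightarrow> a \<bullet> z \<le> 0) \<and> (a \<bullet> x \<ge> 0 \<longrightarrow> a \<bullet> z \<ge> 0)" if "a \<in> A" for a
    using zT sub that by (auto simp: cell_def)
  have "T = cell A z"
  proof (intro equalityI subsetI)
    fix y assume y: "y \<in> T"
    have yx: "(a \<bullet> x \<le> 0 \<longrightarrow> a \<bullet> y \<le> 0) \<and> (a \<bullet> x \<ge> 0 \<longrightarrow> a \<bullet> y \<ge> 0)" if "a \<in> A" for a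
      using y sub that by (auto simp: cell_def)
    obtain e where e: "e > 1" "(1 - e) *\<^sub>R y + e *\<^sub>R z \<in> T"
      using convex_rel_interior_if[OF conv z] y hull_inc[of y T affine] by blast
    have ex: "(a \<bullet> x \<le> 0 \<longrightarrow> (1 - e) * (a \<bullet> y) + e * (a \<bullet> z) \<le> 0) \<and> (a \<bullet> x \<ge> 0 \<longrightarrow> (1 - e) * (a \<bullet> y) + e * (a \<bullet> z) \<ge> 0)" if "a \<in> A" for a
      using e(2) sub that by (auto simp: cell_def inner_add_right)
    show "y \<in> cell A z"
      unfolding cell_def
    proof (intro CollectI ballI)
      fix a assume a: "a \<in> A"
      have "a \<bullet> y = 0" if "a \<bullet> z = 0"
      proof (cases "a \<bullet> x \<le> 0")
        case True
        then have "(1 - e) * (a \<bullet> y) \<le> 0" using ex[OF a] that by simp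
        then have "a \<bullet> y \<ge> 0" using e(1) by (simp add: mult_le_0_iff)
        then show ?thesis using yx[OF a] True by simp
      next
        case False
        then have "(1 - e) * (a \<bullet> y) \<ge> 0" using ex[OF a] that by simp
        then have "a \<bullet> y \<le> 0" using e(1) by (simp add: zero_le_mult_iff)
        then show ?thesis using yx[OF a] False by simp
      qed
      then show "(a \<bullet> z \<le> 0 \<longrightarrow> a \<bullet> y \<le> 0) \<and> (0 \<le> a \<bullet> z \<longrightarrow> 0 \<le> a \<bullet> y)"
        using yx[OF a] zx[OF a] by linarith
    qed
  next
    fix y assume "y \<in> cell A z"
    then have yz: "(a \<bullet> z \<le> 0 \<longrightarrow> a \<bullet> y \<le> 0) \<and> (a \<bullet> z \<ge> 0 \<longrightarrow> a \<bullet> y \<ge> 0)" if "a \<in> A" for a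
      using that by (auto simp: cell_def)
    have yC: "y \<in> cell A x" unfolding cell_def using yz zx by blast
    show "y \<in> T"
    proof (cases "y = z")
      case False
      have "\<forall>\<^sub>F e in at_right 0. \<forall>a\<in>{a\<in>A. a \<bullet> z \<noteq> 0}. sgn (a \<bullet> (z + e *\<^sub>R (z - y))) = sgn (a \<bullet> z)"
        using assms(1) by (intro eventually_ball_finite ballI eventually_keeps_sign) auto
      moreover have "\<forall>\<^sub>F e in at_right (0::real). e > 0" by (simp add: eventually_at_right_less)
      ultimately have "\<forall>\<^sub>F e in at_right 0. e > 0 \<and> (\<forall>a\<in>{a\<in>A. a \<bullet> z \<noteq> 0}. sgn (a \<bullet> (z + e *\<^sub>R (z - y))) = sgn (a \<bullet> z))"
        by eventually_elim auto
      then obtain e :: real where e: "e > 0" "\<And>a. a \<in> A \<Longrightarrow> a \<bullet> z \<noteq> 0 \<Longrightarrow> sgn (a \<bullet> (z + e *\<^sub>R (z - y))) = sgn (a \<bullet> z)"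
        using eventually_happens'[OF trivial_limit_at_right_real] by blast
      define w where "w = z + e *\<^sub>R (z - y)"
      have "sgn (a \<bullet> w) = sgn (a \<bullet> z)" if "a \<in> A" for a
      proof (cases "a \<bullet> z = 0")
        case True
        then have "a \<bullet> y = 0" using yz[OF that] by simp
        then show ?thesis using True by (simp add: w_def inner_add_right inner_diff_right)
      next
        case False then show ?thesis using e(2) that by (simp add: w_def)
      qed
      then have wC: "w \<in> cell A x" using cell_same_signs zT sub by blast
      have "z = (1 - 1 / (1 + e)) *\<^sub>R y + (1 / (1 + e)) *\<^sub>R w"
      proof -
        have "(1 + e) * (1 - 1 / (1 + e)) = e" using e(1) by (simp add: field_simps)
        then have "(1 + e) *\<^sub>R ((1 - 1 / (1 + e)) *\<^sub>R y + (1 / (1 + e)) *\<^sub>R w) = e *\<^sub>R y + w"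
          using e(1) by (simp add: scaleR_add_right)
        also have "\<dots> = (1 + e) *\<^sub>R z" by (simp add: w_def algebra_simps)
        finally show ?thesis using e(1) by (metis add_pos_pos less_irrefl scaleR_cancel_left zero_less_one)
      qed
      moreover have "y \<noteq> w"
      proof
        assume "y = w"
        then have "(1 + e) *\<^sub>R (y - z) = 0" by (simp add: w_def algebra_simps)
        then show False using e(1) False by simp
      qed
      ultimately have "z \<in> open_segment y w"
        unfolding in_segment using e(1) by (intro conjI exI[of _ "1 / (1 + e)"]) auto
      then show ?thesis using assms(2) yC wC zT unfolding face_of_def by blast
    qed (simp add: zT)
  qed
  then show ?thesis using zT by blast
qed

text \<open>A form in \<open>D\<close> has weakly opposite signs at \<open>x\<close> and
  \<open>y\<close>, so it vanishes on the intersection, and its kernel supports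
  \<open>cell A x\<close>. These kernels cut out the intersection, as every other form has the same
  strict sign at \<open>x\<close> and \<open>y\<close>.\<close>

lemma cell_Int_face:
  fixes x y :: "'v::euclidean_space"
  assumes "finite A"
  shows "cell A x \<inter> cell A y face_of cell A x"
proof -
  define D where "D = {a\<in>A. (a \<bullet> x \<le> 0 \<and> a \<bullet> y \<ge> 0) \<or> (a \<bullet> x \<ge> 0 \<and> a \<bullet> y \<le> 0)}"
  have conv: "convex (cell A x)"
    using polyhedral_cone_cell[OF assms, of x] by (simp add: polyhedral_cone_def polyhedron_imp_convex)
  have eq: "cell A x \<inter> cell A y = \<Inter>(insert (cell A x) ((\<lambda>a. cell A x \<inter> {z. a \<bullet> z = 0}) ` D))"
  proof (intro equalityI subsetI)
    fix z assume z: "z \<in> cell A x \<inter> cell A y"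
    have "a \<bullet> z = 0" if "a \<in> D" for a using z that unfolding D_def cell_def by fastforce
    then show "z \<in> \<Inter>(insert (cell A x) ((\<lambda>a. cell A x \<inter> {z. a \<bullet> z = 0}) ` D))" using z by auto
  next
    fix z assume z: "z \<in> \<Inter>(insert (cell A x) ((\<lambda>a. cell A x \<inter> {z. a \<bullet> z = 0}) ` D))"
    have zx: "(a \<bullet> x \<le> 0 \<longrightarrow> a \<bullet> z \<le> 0) \<and> (a \<bullet> x \<ge> 0 \<longrightarrow> a \<bullet> z \<ge> 0)" if "a \<in> A" for a
      using z that by (auto simp: cell_def)
    have z0: "a \<bullet> z = 0" if "a \<in> D" for a using z that by blast
    have "(a \<bullet> y \<le> 0 \<longrightarrow> a \<bullet> z \<le> 0) \<and> (a \<bullet> y \<ge> 0 \<longrightarrow> a \<bullet> z \<ge> 0)" if "a \<in> A" for a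
    proof (cases "a \<in> D")
      case True then show ?thesis using z0 by simp
    next
      case False then show ?thesis using zx[OF that] that by (auto simp: D_def)
    qed
    then show "z \<in> cell A x \<inter> cell A y" using z by (auto simp: cell_def)
  qed
  have "cell A x \<inter> {z. a \<bullet> z = 0} face_of cell A x" if "a \<in> D" for a
  proof -
    consider "a \<bullet> x \<le> 0" | "a \<bullet> x \<ge> 0" by linarith
    then show ?thesis
    proof cases
      case 1
      then show ?thesis using that
        by (intro face_of_Int_supporting_hyperplane_le conv) (auto simp: cell_def D_def)
    next
      case 2
      then show ?thesis using that
        by (intro face_of_Int_supporting_hyperplane_ge conv) (auto simp: cell_def D_def)
    qed
  qed
  then show ?thesis
    unfolding eq by (intro face_of_Inter) (auto simp: face_of_refl conv)
qed

lemma finite_cells: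
  assumes "finite A"
  shows "finite (cell A ` S)"
proof -
  have "cell A ` S \<subseteq> (\<lambda>(P, Q). {y. (\<forall>a\<in>P. a \<bullet> y \<le> 0) \<and> (\<forall>a\<in>Q. a \<bullet> y \<ge> 0)}) ` (Pow A \<times> Pow A)"
  proof
    fix C assume "C \<in> cell A ` S"
    then obtain x where "C = cell A x" by blast
    then have "C = (\<lambda>(P, Q). {y. (\<forall>a\<in>P. a \<bullet> y \<le> 0) \<and> (\<forall>a\<in>Q. a \<bullet> y \<ge> 0)}) ({a\<in>A. a \<bullet> x \<le> 0}, {a\<in>A. a \<bullet> x \<ge> 0})"
      by (auto simp: cell_def)
    then show "C \<in> (\<lambda>(P, Q). {y. (\<forall>a\<in>P. a \<bullet> y \<le> 0) \<and> (\<forall>a\<in>Q. a \<bullet> y \<ge> 0)}) ` (Pow A \<times> Pow A)" by blast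
  qed
  then show ?thesis by (rule finite_subset) (simp add: assms)
qed

theorem finite_polyhedral_fan_cells:
  fixes S :: "'v::euclidean_space set"
  assumes "finite A" "closed S" "S \<noteq> {}"
    and "\<And>x y. x \<in> S \<Longrightarrow> (\<forall>a\<in>A. sgn (a \<bullet> x) = sgn (a \<bullet> y)) \<Longrightarrow> y \<in> S"
  shows "finite_polyhedral_fan (cell A ` S)" "\<Union>(cell A ` S) = S"
proof -
  have sub: "cell A x \<subseteq> S" if "x \<in> S" for x
    by (rule cell_subset[OF assms(2) _ that]) (rule assms(4))
  show "\<Union>(cell A ` S) = S" using sub cell_self by blast
  show "finite_polyhedral_fan (cell A ` S)"
    unfolding finite_polyhedral_fan_def
  proof (intro conjI ballI allI impI)
    show "finite (cell A ` S)" by (rule finite_cells[OF assms(1)])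
    show "cell A ` S \<noteq> {}" using assms(3) by simp
  next
    fix C assume "C \<in> cell A ` S" then show "polyhedral_cone C" using polyhedral_cone_cell[OF assms(1)] by auto
  next
    fix C T assume "C \<in> cell A ` S" "T face_of C \<and> T \<noteq> {}"
    then obtain x z where "x \<in> S" "C = cell A x" "z \<in> T" "T = cell A z"
      using cell_face_is_cell[OF assms(1)] by blast
    then show "T \<in> cell A ` S" using sub[of x] face_of_imp_subset \<open>T face_of C \<and> T \<noteq> {}\<close> by blast
  next
    fix C C' assume "C \<in> cell A ` S" "C' \<in> cell A ` S"
    then obtain x x' where "C = cell A x" "C' = cell A x'" by blast
    then show "C \<inter> C' face_of C" "C \<inter> C' face_of C'"
      using cell_Int_face[OF assms(1), of x x'] cell_Int_face[OF assms(1), of x' x]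
      by (simp_all add: Int_commute)
  qed
qed

text \<open>The equations of \<open>H\<close> vanish at \<open>x\<close>, hence on its cell once
  they belong to \<open>A\<close>. Enlarging \<open>A\<close> thus confines cells to chosen
  subspaces.\<close>

lemma aff_dim_cell_le:
  fixes x :: "'v::euclidean_space"
  assumes "subspace H" "x \<in> H" "B \<subseteq> A" "\<And>y. (\<forall>b\<in>B. b \<bullet> y = 0) \<longleftrightarrow> y \<in> H"
  shows "aff_dim (cell A x) \<le> int (dim H)"
proof -
  have "cell A x \<subseteq> H"
  proof
    fix y assume "y \<in> cell A x"
    moreover have "\<forall>b\<in>B. b \<bullet> x = 0" using assms by blast
    ultimately have "\<forall>b\<in>B. b \<bullet> y = 0" using assms(3) by (fastforce simp: cell_def)
    then show "y \<in> H" using assms(4) by blast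
  qed
  then show ?thesis using aff_dim_subset[of "cell A x" H] aff_dim_subspace[OF assms(1)] by simp
qed

lemma subspace_equations:
  fixes H :: "'v::euclidean_space set"
  assumes "subspace H"
  shows "\<exists>B. finite B \<and> (\<forall>y. (\<forall>b\<in>B. b \<bullet> y = 0) \<longleftrightarrow> y \<in> H)"
proof -
  obtain B where B': "B \<subseteq> orthogonal_comp H" "independent B" "orthogonal_comp H \<subseteq> span B"
    by (rule basis_exists)
  have B: "finite B" "span B = orthogonal_comp H"
    using B' finiteI_independent span_minimal[OF B'(1) subspace_orthogonal_comp] by auto
  have "(\<forall>b\<in>B. b \<bullet> y = 0) \<longleftrightarrow> y \<in> H" for y
  proof -
    have "(\<forall>b\<in>B. b \<bullet> y = 0) \<longleftrightarrow> (\<forall>b\<in>span B. orthogonal b y)"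
    proof
      assume "\<forall>b\<in>B. b \<bullet> y = 0"
      then have "orthogonal y b" if "b \<in> B" for b using that by (simp add: orthogonal_def inner_commute)
      then have "orthogonal y b" if "b \<in> span B" for b using orthogonal_to_span that by blast
      then show "\<forall>b\<in>span B. orthogonal b y" by (simp add: orthogonal_commute)
    qed (auto simp: orthogonal_def span_base)
    also have "\<dots> \<longleftrightarrow> y \<in> orthogonal_comp (orthogonal_comp H)"
      unfolding B(2) by (auto simp: orthogonal_comp_def)
    also have "\<dots> \<longleftrightarrow> y \<in> H" using orthogonal_comp_self[OF assms] by simp
    finally show ?thesis .
  qed
  then show ?thesis using B(1) by blast
qed

text \<open>A point of \<open>U\<close> with as few vanishing forms as possible: a form that vanishes there cannot
  be made nonzero by moving in a direction of \<open>V\<close>, so its cell is full-dimensional along \<open>V\<close>.\<close>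

lemma cell_of_large_dim:
  fixes U :: "'v::euclidean_space set"
  assumes "finite A" "U \<noteq> {}" "independent V"
    and U: "\<And>x v. x \<in> U \<Longrightarrow> v \<in> V \<Longrightarrow> \<forall>\<^sub>F e in at_right 0. x + e *\<^sub>R v \<in> U"
  shows "\<exists>x\<in>U. int (card V) \<le> aff_dim (cell A x)"
proof -
  let ?N = "\<lambda>x. card {a\<in>A. a \<bullet> x \<noteq> 0}"
  obtain u where "u \<in> U" using assms(2) by blast
  moreover have "\<forall>y. y \<in> U \<longrightarrow> ?N y < Suc (card A)" using assms(1) by (auto simp: less_Suc_eq_le intro!: card_mono)
  ultimately obtain x where x: "x \<in> U" "\<And>y. y \<in> U \<Longrightarrow> ?N y \<le> ?N x"
    using Lattices_Big.ex_has_greatest_nat[of "\<lambda>x. x \<in> U" u ?N "Suc (card A)"] by blast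
  have "\<exists>e>0. x + e *\<^sub>R v \<in> cell A x" if v: "v \<in> V" for v
  proof -
    have "\<forall>\<^sub>F e in at_right 0. \<forall>a\<in>{a\<in>A. a \<bullet> x \<noteq> 0}. sgn (a \<bullet> (x + e *\<^sub>R v)) = sgn (a \<bullet> x)"
      using assms(1) by (intro eventually_ball_finite ballI eventually_keeps_sign) auto
    moreover have "\<forall>\<^sub>F e in at_right (0::real). e > 0" by (simp add: eventually_at_right_less)
    ultimately have "\<forall>\<^sub>F e in at_right 0. e > 0 \<and> x + e *\<^sub>R v \<in> U \<and>
        (\<forall>a\<in>{a\<in>A. a \<bullet> x \<noteq> 0}. sgn (a \<bullet> (x + e *\<^sub>R v)) = sgn (a \<bullet> x))"
      using U[OF x(1) v] by eventually_elim auto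
    then obtain e where e: "e > 0" "x + e *\<^sub>R v \<in> U"
        "\<And>a. a \<in> A \<Longrightarrow> a \<bullet> x \<noteq> 0 \<Longrightarrow> sgn (a \<bullet> (x + e *\<^sub>R v)) = sgn (a \<bullet> x)"
      using eventually_happens'[OF trivial_limit_at_right_real] by blast
    have "{a\<in>A. a \<bullet> x \<noteq> 0} \<subseteq> {a\<in>A. a \<bullet> (x + e *\<^sub>R v) \<noteq> 0}"
    proof
      fix a assume "a \<in> {a\<in>A. a \<bullet> x \<noteq> 0}"
      then have "a \<in> A" "sgn (a \<bullet> (x + e *\<^sub>R v)) \<noteq> 0" using e(3)[of a] by (auto simp: sgn_0_0)
      then show "a \<in> {a\<in>A. a \<bullet> (x + e *\<^sub>R v) \<noteq> 0}" by (simp add: sgn_0_0)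
    qed
    \<comment> \<open>No further form becomes nonzero at the moved point, since their number at
      \<open>x\<close> is maximal.\<close>
    then have "{a\<in>A. a \<bullet> x \<noteq> 0} = {a\<in>A. a \<bullet> (x + e *\<^sub>R v) \<noteq> 0}"
      using x(2)[OF e(2)] assms(1) by (intro card_seteq) auto
    then have "sgn (a \<bullet> (x + e *\<^sub>R v)) = sgn (a \<bullet> x)" if "a \<in> A" for a
      using e(3) that by (cases "a \<bullet> x = 0") auto
    then have "x + e *\<^sub>R v \<in> cell A x" using cell_same_signs[OF cell_self] by blast
    then show ?thesis using e(1) by blast
  qed
  then obtain e where e: "\<And>v. v \<in> V \<Longrightarrow> e v > 0" "\<And>v. v \<in> V \<Longrightarrow> x + e v *\<^sub>R v \<in> cell A x" by metis
  have "V \<subseteq> span ((+) (- x) ` cell A x)"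
  proof
    fix v assume v: "v \<in> V"
    have "- x + (x + e v *\<^sub>R v) \<in> (+) (- x) ` cell A x" using e(2)[OF v] by blast
    then have "inverse (e v) *\<^sub>R (e v *\<^sub>R v) \<in> span ((+) (- x) ` cell A x)"
      by (intro span_mul span_base) simp
    then show "v \<in> span ((+) (- x) ` cell A x)" using e(1)[OF v] by simp
  qed
  then have "card V \<le> dim ((+) (- x) ` cell A x)"
    using independent_card_le_dim[OF _ assms(3)] by (metis dim_span)
  moreover have "aff_dim (cell A x) = int (dim ((+) (- x) ` cell A x))"
    by (intro aff_dim_eq_dim hull_inc cell_self)
  ultimately show ?thesis using x(1) by (intro bexI[of _ x]) simp_all
qed

section \<open>Rotations degenerating to calls\<close>

lemma exp_decay_tendsto: "0 < d \<Longrightarrow> ((\<lambda>u::real. exp (- (d * u))) \<longlongrightarrow> 0) at_top"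
  by (rule filterlim_compose[OF exp_at_bot])
    (auto simp: filterlim_uminus_at_bot
      intro!: filterlim_tendsto_pos_mult_at_top[OF tendsto_const _ filterlim_ident])

text \<open>Independence is an open condition. For a basis \<open>B\<close> of the span of the
  limits, the linear map \<open>T u\<close> sends \<open>b\<close> to the vector
  \<open>v u (g b)\<close> that converges to it; for large \<open>u\<close> it is close to the
  identity on \<open>span B\<close>, hence injective there.\<close>

lemma dim_image_limit_le:
  fixes v :: "real \<Rightarrow> nat \<Rightarrow> 'v::euclidean_space"
  assumes lim: "\<And>r. r \<in> I \<Longrightarrow> ((\<lambda>u. v u r) \<longlongrightarrow> v0 r) at_top"
    and dim: "\<forall>\<^sub>F u in at_top. dim (v u ` I) \<le> m"
  shows "dim (v0 ` I) \<le> m"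
proof -
  obtain B where B: "B \<subseteq> v0 ` I" "independent B" "card B = dim (v0 ` I)" by (rule basis_exists)
  have fin: "finite B" using B(2) finiteI_independent by blast
  have "\<forall>b\<in>B. \<exists>r. r \<in> I \<and> v0 r = b" using B(1) by blast
  then obtain g where g: "\<And>b. b \<in> B \<Longrightarrow> g b \<in> I" "\<And>b. b \<in> B \<Longrightarrow> v0 (g b) = b"
    by (auto dest!: bchoice)
  have "\<exists>\<phi>. linear \<phi> \<and> (\<forall>b'\<in>B. \<phi> b' = (if b = b' then 1 else 0 :: real))" for b
    using linear_independent_extend[OF B(2), of "\<lambda>b'. if b = b' then 1 else 0 :: real"] by blast
  then obtain \<phi> where \<phi>: "\<And>b. linear (\<phi> b)" "\<And>b b'. b' \<in> B \<Longrightarrow> \<phi> b b' = (if b = b' then 1 else 0 :: real)"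
    by metis
  have "\<exists>K>0. \<forall>x. norm (\<phi> b x) \<le> K * norm x" for b using linear_bounded_pos[OF \<phi>(1)] by blast
  then obtain K where K: "\<And>b. K b > 0" "\<And>b x. norm (\<phi> b x) \<le> K b * norm x" by metis
  define T where "T u x = (\<Sum>b\<in>B. \<phi> b x *\<^sub>R v u (g b))" for u x
  have lin: "linear (\<lambda>x. \<Sum>b\<in>B. \<phi> b x *\<^sub>R h b)" for h :: "'v \<Rightarrow> 'v"
    by (rule linearI)
      (simp_all add: linear_add[OF \<phi>(1)] linear_cmul[OF \<phi>(1)] scaleR_add_left sum.distrib scaleR_sum_right)
  have linT: "linear (T u)" for u unfolding T_def by (rule lin)
  have id: "(\<Sum>b\<in>B. \<phi> b x *\<^sub>R b) = x" if "x \<in> span B" for x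
  proof -
    have "(\<Sum>b\<in>B. \<phi> b b' *\<^sub>R b) = b'" if "b' \<in> B" for b'
    proof -
      have "(\<Sum>b\<in>B. \<phi> b b' *\<^sub>R b) = (\<Sum>b\<in>B. if b = b' then b else 0)"
        by (intro sum.cong) (auto simp: \<phi>(2)[OF that])
      then show ?thesis using that fin by (simp add: sum.delta')
    qed
    then show ?thesis by (rule linear_eq_on_span[OF lin linear_ident _ that])
  qed
  \<comment> \<open>This sum bounds the norm of \<open>T u\<close> minus the identity on
    \<open>span B\<close>; below \<open>1\<close> it leaves only a trivial kernel.\<close>
  have "((\<lambda>u. \<Sum>b\<in>B. K b * norm (v u (g b) - b)) \<longlongrightarrow> (\<Sum>b\<in>B. K b * norm (v0 (g b) - b))) at_top"
    by (intro tendsto_intros lim g(1))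
  moreover have "(\<Sum>b\<in>B. K b * norm (v0 (g b) - b)) = 0" by (intro sum.neutral) (simp add: g(2))
  ultimately have "\<forall>\<^sub>F u in at_top. (\<Sum>b\<in>B. K b * norm (v u (g b) - b)) < 1"
    by (intro order_tendstoD) auto
  then have "\<forall>\<^sub>F u in at_top. (\<Sum>b\<in>B. K b * norm (v u (g b) - b)) < 1 \<and> dim (v u ` I) \<le> m"
    using dim by eventually_elim simp
  then obtain u where u: "(\<Sum>b\<in>B. K b * norm (v u (g b) - b)) < 1" "dim (v u ` I) \<le> m"
    using eventually_happens'[OF trivial_limit_at_top_linorder] by blast
  have "inj_on (T u) (span B)"
  proof (subst linear_inj_on_iff_eq_0[OF linT subspace_span], intro ballI impI)
    fix x assume x: "x \<in> span B" "T u x = 0"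
    have "norm x = norm ((\<Sum>b\<in>B. \<phi> b x *\<^sub>R v u (g b)) - (\<Sum>b\<in>B. \<phi> b x *\<^sub>R b))"
      using x by (simp add: id T_def)
    also have "\<dots> = norm (\<Sum>b\<in>B. \<phi> b x *\<^sub>R (v u (g b) - b))"
      by (simp add: sum_subtractf scaleR_diff_right)
    also have "\<dots> \<le> (\<Sum>b\<in>B. norm (\<phi> b x *\<^sub>R (v u (g b) - b)))" by (rule norm_sum)
    also have "\<dots> \<le> (\<Sum>b\<in>B. (K b * norm x) * norm (v u (g b) - b))"
      using K(2) by (intro sum_mono) (auto intro!: mult_right_mono)
    also have "\<dots> = (\<Sum>b\<in>B. K b * norm (v u (g b) - b)) * norm x"
      unfolding sum_distrib_right by (simp only: mult_ac)
    finally have "norm x \<le> (\<Sum>b\<in>B. K b * norm (v u (g b) - b)) * norm x" .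
    then have "(1 - (\<Sum>b\<in>B. K b * norm (v u (g b) - b))) * norm x \<le> 0" by (simp add: algebra_simps)
    then show "x = 0" using u(1) by (simp add: mult_le_0_iff)
  qed
  then have "dim (T u ` B) = dim B" by (rule dim_image_eq[OF linT])
  moreover have "dim B = card B" using B(2) by (rule dim_eq_card_independent)
  moreover have "T u ` B \<subseteq> v u ` I"
  proof (rule image_subsetI)
    fix b assume b: "b \<in> B"
    have "T u b = (\<Sum>b'\<in>B. if b' = b then v u (g b) else 0)"
      unfolding T_def by (intro sum.cong) (auto simp: \<phi>(2)[OF b])
    then show "T u b \<in> v u ` I" using b fin g(1) by (simp add: sum.delta')
  qed
  ultimately show ?thesis using dim_subset[of "T u ` B" "v u ` I"] u(2) B(3) by simp
qed

lemma dim_skew_symmetric_le: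
  "dim {K :: real ^ 'n::finite ^ 'n. transpose K = - K} \<le> CARD('n) choose 2"
proof -
  define P where "P = {s :: 'n set. s \<subseteq> UNIV \<and> card s = 2}"
  have "\<forall>s\<in>P. \<exists>z. s = {fst z, snd z} \<and> fst z \<noteq> snd z" by (auto simp: P_def card_2_iff)
  \<comment> \<open>The index type has no order, so each two-element set gets a chosen
    orientation.\<close>
  from bchoice[OF this] obtain h where "\<forall>s\<in>P. s = {fst (h s), snd (h s)} \<and> fst (h s) \<noteq> snd (h s)" ..
  then obtain f g where fg: "\<And>s. s \<in> P \<Longrightarrow> s = {f s, g s} \<and> f s \<noteq> g s"
    using that[of "\<lambda>s. fst (h s)" "\<lambda>s. snd (h s)"] by blast
  define e :: "'n set \<Rightarrow> real ^ 'n ^ 'n" where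
    "e s = (\<chi> p q. if p = f s \<and> q = g s then 1 else if p = g s \<and> q = f s then - 1 else 0)" for s
  have "{K :: real ^ 'n ^ 'n. transpose K = - K} \<subseteq> span (e ` P)"
  proof
    fix K :: "real ^ 'n ^ 'n" assume "K \<in> {K. transpose K = - K}"
    then have T: "transpose K = - K" by simp
    have K: "K $ j $ i = - K $ i $ j" for i j
      using arg_cong[OF T, of "\<lambda>A. A $ i $ j"]
      by (simp only: transpose_def vec_lambda_beta vector_uminus_component)
    have "K = (\<Sum>s\<in>P. K $ f s $ g s *\<^sub>R e s)"
    proof -
      have "(\<Sum>s\<in>P. K $ f s $ g s *\<^sub>R e s) $ p $ q = K $ p $ q" for p q
      proof -
        have "(\<Sum>s\<in>P. K $ f s $ g s *\<^sub>R e s) $ p $ q = (\<Sum>s\<in>P. K $ f s $ g s * e s $ p $ q)" by simp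
        also have "\<dots> = (\<Sum>s\<in>P. if s = {p, q} then K $ p $ q else 0)"
        proof (intro sum.cong refl)
          fix s assume "s \<in> P"
          then have s: "s = {f s, g s}" "f s \<noteq> g s" using fg by auto
          show "K $ f s $ g s * e s $ p $ q = (if s = {p, q} then K $ p $ q else 0)"
          proof (cases "s = {p, q}")
            case True
            then have "{p, q} = {f s, g s}" using s(1) by (rule trans[OF sym])
            then have "p = f s \<and> q = g s \<or> p = g s \<and> q = f s" by (simp only: doubleton_eq_iff)
            then show ?thesis
            proof
              assume "p = f s \<and> q = g s"
              with True show ?thesis by (simp add: e_def)
            next
              assume "p = g s \<and> q = f s"
              with True s(2) K[of q p] show ?thesis by (simp add: e_def)
            qed
          next
            case False
            then have "\<not> (p = f s \<and> q = g s)" "\<not> (p = g s \<and> q = f s)" using s(1) by blast+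
            then have "e s $ p $ q = 0" by (simp add: e_def)
            with False show ?thesis by simp
          qed
        qed
        also have "\<dots> = (if {p, q} \<in> P then K $ p $ q else 0)" by (simp add: sum.delta)
        also have "\<dots> = K $ p $ q"
        proof (cases "p = q")
          case True then show ?thesis using K[of p p] by (simp add: P_def)
        next
          case False then show ?thesis by (simp add: P_def)
        qed
        finally show ?thesis .
      qed
      then show ?thesis by (simp add: vec_eq_iff)
    qed
    also have "\<dots> \<in> span (e ` P)" by (intro span_sum span_scale span_base) auto
    finally show "K \<in> span (e ` P)" .
  qed
  then have "dim {K :: real ^ 'n ^ 'n. transpose K = - K} \<le> card (e ` P)"
    by (rule dim_le_card) simp
  also have "\<dots> \<le> card P" by (intro card_image_le) simp
  also have "\<dots> = CARD('n) choose 2" unfolding P_def by (rule n_subsets) simp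
  finally show ?thesis .
qed

section \<open>Plane rotations and generic losses\<close>

text \<open>Right multiplication mixes columns \<open>k\<close> and \<open>l\<close> only, as a call
  does; \<open>c\<close> and \<open>s\<close> stand for cosine and sine.\<close>

definition rotation :: "'n \<Rightarrow> 'n \<Rightarrow> real \<Rightarrow> real \<Rightarrow> real ^ 'n ^ 'n" where
  "rotation k l c s = (\<chi> q j.
     if j = k then (if q = k then c else 0) + (if q = l then - s else 0)
     else if j = l then (if q = l then c else 0) + (if q = k then s else 0)
     else if q = j then 1 else 0)"

lemma matrix_mult_rotation:
  fixes M :: "real ^ 'n::finite ^ 'n"
  shows "(M ** rotation k l c s) $ i $ j =
    (if j = k then c * M $ i $ k - s * M $ i $ l
     else if j = l then c * M $ i $ l + s * M $ i $ k else M $ i $ j)"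
proof -
  have delta: "(\<Sum>q\<in>UNIV. M $ i $ q * (if q = a then b else 0)) = M $ i $ a * b" for a b
    by (simp add: if_distrib cong: if_cong)
  show ?thesis
    by (simp add: matrix_matrix_mult_def rotation_def distrib_left sum.distrib delta mult.commute)
qed

lemma rotation_mult_transpose:
  fixes k l :: "'n::finite"
  assumes "k \<noteq> l" "c\<^sup>2 + s\<^sup>2 = 1"
  shows "rotation k l c s ** transpose (rotation k l c s) = mat 1"
proof -
  have "transpose (rotation k l c s) = rotation k l c (- s)"
    using assms(1) by (auto simp: transpose_def rotation_def vec_eq_iff)
  moreover have "(rotation k l c s ** rotation k l c (- s)) $ i $ j = (mat 1 :: real ^ 'n ^ 'n) $ i $ j" for i j
    using assms by (auto simp: matrix_mult_rotation) (auto simp: rotation_def mat_def power2_eq_square algebra_simps)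
  then have "rotation k l c s ** rotation k l c (- s) = (mat 1 :: real ^ 'n ^ 'n)" by (simp add: vec_eq_iff)
  ultimately show ?thesis by simp
qed

text \<open>Conjugation by an orthogonal matrix preserves skew symmetry. Hence tangent vectors keep
  the form \<open>M ** K\<close> under further rotations.\<close>

lemma skew_tangent_rotation:
  fixes M R K :: "real ^ 'n::finite ^ 'n"
  assumes "R ** transpose R = mat 1" "transpose K = - K"
  shows "\<exists>K'. transpose K' = - K' \<and> (M ** K) ** R = (M ** R) ** K'"
proof (intro exI conjI)
  let ?K = "transpose R ** K ** R"
  have "transpose ?K = transpose R ** (transpose K ** R)"
    by (simp add: matrix_transpose_mul transpose_transpose)
  then show "transpose ?K = - ?K" by (simp add: assms(2) matrix_mul_assoc)
      (simp add: matrix_matrix_mult_def vec_eq_iff sum_negf)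
  have "(M ** R) ** ?K = M ** (R ** transpose R) ** K ** R" by (simp add: matrix_mul_assoc)
  then show "(M ** K) ** R = (M ** R) ** ?K" by (simp add: assms(1))
qed

text \<open>Parameters are numbered in the order of the calls, from the end of the list, so
  prepending a later call leaves the earlier indices unchanged.\<close>

primrec with_params :: "('n \<times> 'n) list \<Rightarrow> (nat \<Rightarrow> 'a) \<Rightarrow> ('n \<times> 'n \<times> 'a) list" where
  "with_params [] \<theta> = []"
| "with_params (p # w) \<theta> = (fst p, snd p, \<theta> (length w)) # with_params w \<theta>"

text \<open>Ties are excluded in every minimum that a call takes, so one branch is strictly smaller
  and decides the limit.\<close>

primrec generic_params :: "real \<Rightarrow> ('n::finite \<times> 'n) list \<Rightarrow> (nat \<Rightarrow> real) \<Rightarrow> bool" where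
  "generic_params b [] \<theta> = True"
| "generic_params b (p # w) \<theta> = (generic_params b w \<theta> \<and> 0 < \<theta> (length w) \<and>
     (\<forall>i. \<bar>calls (uniform_matrix b) (with_params w \<theta>) $ i $ fst p
         - calls (uniform_matrix b) (with_params w \<theta>) $ i $ snd p\<bar> \<noteq> \<theta> (length w)))"

text \<open>Data attached to the entries are copied along the branch that the call selects. With
  \<open>\<sigma> = - 1\<close> these are leading coefficients, matching the entry
  \<open>- s\<close> of \<open>rotation\<close>; with \<open>\<sigma> = 1\<close> they are
  coefficients of linear forms.\<close>

definition follow_call :: "'n \<Rightarrow> 'n \<Rightarrow> real \<Rightarrow> real ^ 'n ^ 'n \<Rightarrow> real \<Rightarrow> real ^ 'n ^ 'n \<Rightarrow> real ^ 'n ^ 'n" where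
  "follow_call k l a X \<sigma> C = (\<chi> i j. if j = k \<and> X $ i $ l + a < X $ i $ k then \<sigma> * C $ i $ l
     else if j = l \<and> X $ i $ k + a < X $ i $ l then C $ i $ k else C $ i $ j)"

definition call_used :: "'n \<Rightarrow> 'n \<Rightarrow> real \<Rightarrow> real ^ 'n ^ 'n \<Rightarrow> real ^ 'n ^ 'n" where
  "call_used k l a X = (\<chi> i j. if j = k \<and> X $ i $ l + a < X $ i $ k \<or> j = l \<and> X $ i $ k + a < X $ i $ l
     then 1 else 0)"

lemma call_update_eq_follow:
  assumes "k \<noteq> l"
  shows "call_update k l a X = follow_call k l a X 1 X + a *\<^sub>R call_used k l a X"
  using assms by (auto simp: vec_eq_iff call_update_def follow_call_def call_used_def min_def)

lemma follow_call_linear: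
  "follow_call k l a X 1 (\<Sum>r\<in>I. t r *\<^sub>R p r) = (\<Sum>r\<in>I. t r *\<^sub>R follow_call k l a X 1 (p r))"
  "follow_call k l a X 1 (Y + Z) = follow_call k l a X 1 Y + follow_call k l a X 1 Z"
  "follow_call k l a X 1 (c *\<^sub>R Y) = c *\<^sub>R follow_call k l a X 1 Y"
  by (auto simp: vec_eq_iff follow_call_def)

text \<open>Of two exponentially decaying summands the one with the smaller exponent prevails, which
  turns a sum into a minimum. Here it is \<open>f\<close>; in \<open>tendsto_dominated\<close> it is
  \<open>g\<close>.\<close>

lemma tendsto_dominant:
  fixes f g :: "real \<Rightarrow> real"
  assumes "((\<lambda>u. f u * exp (x * u)) \<longlongrightarrow> \<alpha>) at_top" "((\<lambda>u. g u * exp (y * u)) \<longlongrightarrow> \<beta>) at_top"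
    "(cs \<longlongrightarrow> 1) at_top" "x < y + a"
  shows "((\<lambda>u. (cs u * f u + \<sigma> * exp (- (a * u)) * g u) * exp (x * u)) \<longlongrightarrow> \<alpha>) at_top"
proof -
  have "((\<lambda>u. cs u * (f u * exp (x * u)) + \<sigma> * (g u * exp (y * u)) * exp (- ((y + a - x) * u))) \<longlongrightarrow> 1 * \<alpha> + \<sigma> * \<beta> * 0) at_top"
    using assms(4) by (intro tendsto_intros assms exp_decay_tendsto) simp
  moreover have "cs u * (f u * exp (x * u)) + \<sigma> * (g u * exp (y * u)) * exp (- ((y + a - x) * u))
      = (cs u * f u + \<sigma> * exp (- (a * u)) * g u) * exp (x * u)" for u
  proof -
    have "exp (y * u) * exp (- ((y + a - x) * u)) = exp (- (a * u)) * exp (x * u)"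
      by (simp add: algebra_simps flip: exp_add)
    moreover have "p * (q * E) + \<sigma> * (r * A) * B = (p * q + \<sigma> * D * r) * E"
      if "A * B = D * E" for p q r A B D E :: real
    proof -
      have "\<sigma> * (r * A) * B = \<sigma> * r * (A * B)" by simp
      then show ?thesis unfolding that by (simp add: algebra_simps)
    qed
    ultimately show ?thesis by blast
  qed
  ultimately show ?thesis by (simp only:) simp
qed

lemma tendsto_dominated:
  fixes f g :: "real \<Rightarrow> real"
  assumes "((\<lambda>u. f u * exp (x * u)) \<longlongrightarrow> \<alpha>) at_top" "((\<lambda>u. g u * exp (y * u)) \<longlongrightarrow> \<beta>) at_top"
    "(cs \<longlongrightarrow> 1) at_top" "y + a < x"
  shows "((\<lambda>u. (cs u * f u + \<sigma> * exp (- (a * u)) * g u) * exp ((y + a) * u)) \<longlongrightarrow> \<sigma> * \<beta>) at_top"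
proof -
  have "((\<lambda>u. cs u * (f u * exp (x * u)) * exp (- ((x - y - a) * u)) + \<sigma> * (g u * exp (y * u))) \<longlongrightarrow> 1 * \<alpha> * 0 + \<sigma> * \<beta>) at_top"
    using assms(4) by (intro tendsto_intros assms exp_decay_tendsto) simp
  moreover have "cs u * (f u * exp (x * u)) * exp (- ((x - y - a) * u)) + \<sigma> * (g u * exp (y * u))
      = (cs u * f u + \<sigma> * exp (- (a * u)) * g u) * exp ((y + a) * u)" for u
  proof -
    have "exp (x * u) * exp (- ((x - y - a) * u)) = exp ((y + a) * u)"
      "exp (- (a * u)) * exp ((y + a) * u) = exp (y * u)"
      by (simp_all add: algebra_simps flip: exp_add)
    moreover have "p * (q * A) * B + \<sigma> * (r * E) = (p * q + \<sigma> * D * r) * C"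
      if "A * B = C" "D * C = E" for p q r A B C D E :: real
      unfolding that(2)[symmetric] that(1)[symmetric] by (simp add: algebra_simps)
    ultimately show ?thesis by blast
  qed
  ultimately show ?thesis by (simp only:) simp
qed

text \<open>The cosine tends to \<open>1\<close> and the sine is \<open>exp (- (a * u))\<close>, so
  the two summands of a rotated column have exponents \<open>X $ i $ k\<close> and
  \<open>X $ i $ l + a\<close>, or the same with \<open>k\<close> and \<open>l\<close> exchanged:
  just what \<open>call_update\<close> compares.\<close>

lemma rotation_limit:
  fixes G :: "real \<Rightarrow> real ^ 'n::finite ^ 'n"
  assumes "k \<noteq> l" "0 < a" "\<And>i. \<bar>X $ i $ k - X $ i $ l\<bar> \<noteq> a" "(cs \<longlongrightarrow> 1) at_top"
    and G: "\<And>i j. ((\<lambda>u. G u $ i $ j * exp (X $ i $ j * u)) \<longlongrightarrow> C $ i $ j) at_top"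
  shows "((\<lambda>u. (G u ** rotation k l (cs u) (exp (- (a * u)))) $ i $ j * exp (call_update k l a X $ i $ j * u))
     \<longlongrightarrow> follow_call k l a X (- 1) C $ i $ j) at_top"
proof -
  have ties: "X $ i $ k \<noteq> X $ i $ l + a" "X $ i $ l \<noteq> X $ i $ k + a" using assms(2,3) by (smt (verit))+
  consider "j = k" "X $ i $ l + a < X $ i $ k" | "j = k" "X $ i $ k < X $ i $ l + a"
    | "j = l" "X $ i $ k + a < X $ i $ l" | "j = l" "X $ i $ l < X $ i $ k + a" | "j \<noteq> k" "j \<noteq> l"
    using ties by linarith
  then show ?thesis
  proof cases
    case 1
    then show ?thesis using tendsto_dominated[OF G[of i k] G[of i l] assms(4), of a "- 1"]
      by (simp add: matrix_mult_rotation call_update_def follow_call_def)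
  next
    case 2
    then show ?thesis using tendsto_dominant[OF G[of i k] G[of i l] assms(4), of a "- 1"] assms(1)
      by (simp add: matrix_mult_rotation call_update_def follow_call_def min_absorb1)
  next
    case 3
    then show ?thesis using tendsto_dominated[OF G[of i l] G[of i k] assms(4), of a 1] assms(1)
      by (simp add: matrix_mult_rotation call_update_def follow_call_def)
  next
    case 4
    then show ?thesis using tendsto_dominant[OF G[of i l] G[of i k] assms(4), of a 1] assms(1)
      by (simp add: matrix_mult_rotation call_update_def follow_call_def min_absorb1)
  next
    case 5
    then show ?thesis using G[of i j] by (simp add: matrix_mult_rotation call_update_def follow_call_def)
  qed
qed

text \<open>Derivative of the rotation with respect to its angle, at angle zero.\<close>

definition infinitesimal_rotation :: "'n \<Rightarrow> 'n \<Rightarrow> real ^ 'n ^ 'n" where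
  "infinitesimal_rotation k l = (\<chi> q j. if j = k then (if q = l then - 1 else 0)
     else if j = l then (if q = k then 1 else 0) else 0)"

lemma matrix_mult_infinitesimal_rotation:
  fixes M :: "real ^ 'n::finite ^ 'n"
  shows "(M ** infinitesimal_rotation k l) $ i $ j =
    (if j = k then - M $ i $ l else if j = l then M $ i $ k else 0)"
proof -
  have delta: "(\<Sum>q\<in>UNIV. M $ i $ q * (if q = a then b else 0)) = M $ i $ a * b" for a b
    by (simp add: if_distrib cong: if_cong)
  show ?thesis by (simp add: matrix_matrix_mult_def infinitesimal_rotation_def delta)
qed

text \<open>For a product \<open>M' u\<close> ending in this rotation, the derivative in
  \<open>a\<close> is the tangent vector used here times \<open>- u\<close> over the cosine. That
  scalar is dropped: it diverges and does not affect spans.\<close>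

lemma new_tangent_limit:
  fixes M' :: "real \<Rightarrow> real ^ 'n::finite ^ 'n"
  assumes "k \<noteq> l" "0 < a" "\<And>i. \<bar>X $ i $ k - X $ i $ l\<bar> \<noteq> a"
    and M': "\<And>i j. ((\<lambda>u. M' u $ i $ j * exp (call_update k l a X $ i $ j * u))
      \<longlongrightarrow> follow_call k l a X (- 1) C $ i $ j) at_top"
  shows "((\<lambda>u. (M' u ** (exp (- (a * u)) *\<^sub>R infinitesimal_rotation k l)) $ i $ j
        * exp (call_update k l a X $ i $ j * u))
     \<longlongrightarrow> follow_call k l a X (- 1) C $ i $ j * call_used k l a X $ i $ j) at_top"
proof -
  let ?x = "call_update k l a X" and ?c = "follow_call k l a X (- 1) C"
  have eq: "M' u ** (t *\<^sub>R infinitesimal_rotation k l) = t *\<^sub>R (M' u ** infinitesimal_rotation k l)" for u t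
    by (simp add: matrix_matrix_mult_def vec_eq_iff sum_distrib_left mult_ac)
  have ties: "X $ i $ k \<noteq> X $ i $ l + a" "X $ i $ l \<noteq> X $ i $ k + a" using assms(2,3) by (smt (verit))+
  have used: "((\<lambda>u. exp (- (a * u)) * M' u $ i $ q * exp (?x $ i $ j * u)) \<longlongrightarrow> ?c $ i $ q) at_top"
    if "?x $ i $ j = ?x $ i $ q + a" for q
  proof -
    have "exp (- (a * u)) * M' u $ i $ q * exp (?x $ i $ j * u) = M' u $ i $ q * exp (?x $ i $ q * u)" for u
    proof -
      have "exp (- (a * u)) * exp (?x $ i $ j * u) = exp (?x $ i $ q * u)"
        unfolding that by (simp add: algebra_simps flip: exp_add)
      then show ?thesis by (simp add: mult_ac)
    qed
    then show ?thesis using M'[of i q] by (simp only:)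
  qed
  have unused: "((\<lambda>u. exp (- (a * u)) * M' u $ i $ q * exp (?x $ i $ j * u)) \<longlongrightarrow> 0) at_top"
    if "?x $ i $ j < ?x $ i $ q + a" for q
  proof -
    have "exp (- (a * u)) * M' u $ i $ q * exp (?x $ i $ j * u)
        = (M' u $ i $ q * exp (?x $ i $ q * u)) * exp (- ((?x $ i $ q + a - ?x $ i $ j) * u))" for u
    proof -
      have "exp (- (a * u)) * exp (?x $ i $ j * u)
          = exp (?x $ i $ q * u) * exp (- ((?x $ i $ q + a - ?x $ i $ j) * u))"
        by (simp add: algebra_simps flip: exp_add)
      then show ?thesis by (simp add: mult_ac)
    qed
    moreover have "((\<lambda>u. (M' u $ i $ q * exp (?x $ i $ q * u)) * exp (- ((?x $ i $ q + a - ?x $ i $ j) * u)))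
        \<longlongrightarrow> ?c $ i $ q * 0) at_top"
      using that by (intro tendsto_mult M' exp_decay_tendsto) simp
    ultimately show ?thesis by (simp only:) simp
  qed
  consider "j = k" "X $ i $ l + a < X $ i $ k" | "j = k" "X $ i $ k < X $ i $ l + a"
    | "j = l" "X $ i $ k + a < X $ i $ l" | "j = l" "X $ i $ l < X $ i $ k + a" | "j \<noteq> k" "j \<noteq> l"
    using ties by linarith
  then show ?thesis
  proof cases
    case 1
    then have "?x $ i $ j = ?x $ i $ l + a" "?c $ i $ j = - ?c $ i $ l" "call_used k l a X $ i $ j = 1"
      using assms(1,2) by (auto simp: call_update_def follow_call_def call_used_def)
    then show ?thesis using 1(1) tendsto_minus[OF used[of l]]
      by (simp add: eq matrix_mult_infinitesimal_rotation)
  next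
    case 2
    then have "?x $ i $ j < ?x $ i $ l + a" "call_used k l a X $ i $ j = 0"
      using assms(1,2) by (auto simp: call_update_def call_used_def)
    then show ?thesis using 2(1) tendsto_minus[OF unused[of l]]
      by (simp add: eq matrix_mult_infinitesimal_rotation)
  next
    case 3
    then have "?x $ i $ j = ?x $ i $ k + a" "?c $ i $ j = ?c $ i $ k" "call_used k l a X $ i $ j = 1"
      using assms(1,2) by (auto simp: call_update_def follow_call_def call_used_def)
    then show ?thesis using 3(1) used[of k] assms(1)
      by (simp add: eq matrix_mult_infinitesimal_rotation)
  next
    case 4
    then have "?x $ i $ j < ?x $ i $ k + a" "call_used k l a X $ i $ j = 0"
      using assms(1,2) by (auto simp: call_update_def call_used_def)
    then show ?thesis using 4(1) unused[of k] assms(1)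
      by (simp add: eq matrix_mult_infinitesimal_rotation)
  next
    case 5
    then show ?thesis by (simp add: eq matrix_mult_infinitesimal_rotation call_used_def)
  qed
qed

section \<open>The dimension bound\<close>

text \<open>Here \<open>M\<close> is the product of the rotations, started at a matrix that need not be orthogonal, \<open>D r\<close> is
  its tangent vector for the loss \<open>r\<close>, and \<open>p r\<close> marks the entries whose optimal path uses call \<open>r\<close>.\<close>

lemma generic_params_structure:
  fixes w :: "('n::finite \<times> 'n) list"
  assumes "generic_params b w \<theta>" "\<forall>p\<in>set w. fst p \<noteq> snd p"
  shows "\<exists>M D C p q. (\<forall>i j. C $ i $ j \<noteq> 0) \<and>
    (\<forall>i j. ((\<lambda>u. M u $ i $ j * exp (calls (uniform_matrix b) (with_params w \<theta>) $ i $ j * u))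
        \<longlongrightarrow> C $ i $ j) at_top) \<and>
    (\<forall>r<length w. \<forall>u>0. \<exists>K. transpose K = - K \<and> D r u = M u ** K) \<and>
    (\<forall>r<length w. \<forall>i j. ((\<lambda>u. D r u $ i $ j * exp (calls (uniform_matrix b) (with_params w \<theta>) $ i $ j * u))
        \<longlongrightarrow> C $ i $ j * p r $ i $ j) at_top) \<and>
    calls (uniform_matrix b) (with_params w \<theta>) = (\<Sum>r<length w. \<theta> r *\<^sub>R p r) + b *\<^sub>R q \<and>
    (\<forall>r i j. p r $ i $ j \<in> {0, 1 :: real}) \<and> (\<forall>i j. q $ i $ j \<in> {0, 1 :: real})"
  using assms
proof (induction w)
  case Nil
  \<comment> \<open>The exponent \<open>b\<close> off the diagonal matches
    \<open>uniform_matrix b\<close>, and all leading coefficients start as \<open>1\<close>.\<close>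
  let ?M = "\<lambda>u. (\<chi> i j. if i = j then 1 else exp (- (b * u))) :: real ^ 'n ^ 'n"
  let ?C = "(\<chi> i j. 1) :: real ^ 'n ^ 'n"
  let ?q = "(\<chi> i j. if i = j then 0 else 1) :: real ^ 'n ^ 'n"
  have "?M u $ i $ j * exp (uniform_matrix b $ i $ j * u) = 1" for u i j
    by (simp add: uniform_matrix_def exp_minus)
  then have "((\<lambda>u. ?M u $ i $ j * exp (uniform_matrix b $ i $ j * u)) \<longlongrightarrow> ?C $ i $ j) at_top" for i j
    by (simp only: vec_lambda_beta tendsto_const)
  moreover have "uniform_matrix b = b *\<^sub>R ?q" by (simp add: uniform_matrix_def vec_eq_iff)
  ultimately show ?case
    by (intro exI[of _ ?M] exI[of _ "\<lambda>_ _. 0"] exI[of _ ?C] exI[of _ "\<lambda>_. 0"] exI[of _ ?q]) auto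
next
  case (Cons z w)
  obtain k l where z: "z = (k, l)" by (cases z)
  define X where "X = calls (uniform_matrix b) (with_params w \<theta>)"
  define a where "a = \<theta> (length w)"
  have kl: "k \<noteq> l" and a: "0 < a" and ties: "\<And>i. \<bar>X $ i $ k - X $ i $ l\<bar> \<noteq> a"
    using Cons.prems by (auto simp: z X_def a_def)
  have X': "calls (uniform_matrix b) (with_params (z # w) \<theta>) = call_update k l a X"
    by (simp add: z X_def a_def)
  have "generic_params b w \<theta>" "\<forall>p\<in>set w. fst p \<noteq> snd p" using Cons.prems by auto
  from Cons.IH[OF this, folded X_def] obtain M D C p q where
    "\<forall>i j. C $ i $ j \<noteq> 0"
    "\<forall>i j. ((\<lambda>u. M u $ i $ j * exp (X $ i $ j * u)) \<longlongrightarrow> C $ i $ j) at_top"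
    "\<forall>r<length w. \<forall>u>0. \<exists>K. transpose K = - K \<and> D r u = M u ** K"
    "\<forall>r<length w. \<forall>i j. ((\<lambda>u. D r u $ i $ j * exp (X $ i $ j * u)) \<longlongrightarrow> C $ i $ j * p r $ i $ j) at_top"
    and Xeq: "X = (\<Sum>r<length w. \<theta> r *\<^sub>R p r) + b *\<^sub>R q"
    and "\<forall>r i j. p r $ i $ j \<in> {0, 1}" "\<forall>i j. q $ i $ j \<in> {0, 1}"
    by (elim exE conjE) (rule that)
  note C = this(1)[rule_format] and M = this(2)[rule_format] and K = this(3)[rule_format]
    and D = this(4)[rule_format] and p01 = this(6)[rule_format] and q01 = this(7)[rule_format]
  define s where "s u = exp (- (a * u))" for u
  define c where "c u = sqrt (1 - (s u)\<^sup>2)" for u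
  define R where "R u = rotation k l (c u) (s u)" for u
  have "((\<lambda>u. sqrt (1 - (s u)\<^sup>2)) \<longlongrightarrow> sqrt (1 - 0\<^sup>2)) at_top"
    unfolding s_def by (intro tendsto_intros exp_decay_tendsto a)
  then have c1: "(c \<longlongrightarrow> 1) at_top" by (simp add: c_def[abs_def])
  have orth: "R u ** transpose (R u) = mat 1" if "u > 0" for u
  proof -
    have "0 \<le> s u" "s u \<le> 1" using a that by (auto simp: s_def)
    then have "(s u)\<^sup>2 \<le> 1" by (simp add: power_le_one)
    then have "(c u)\<^sup>2 + (s u)\<^sup>2 = 1" by (simp add: c_def)
    then show ?thesis unfolding R_def by (rule rotation_mult_transpose[OF kl])
  qed
  define M' where "M' u = M u ** R u" for u
  define J where "J u = s u *\<^sub>R infinitesimal_rotation k l" for u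
  \<comment> \<open>The new loss gets the tangent vector of the new rotation; earlier tangent
    vectors are multiplied by that rotation.\<close>
  define D' where "D' r u = (if r = length w then M' u ** J u else D r u ** R u)" for r u
  define C' where "C' = follow_call k l a X (- 1) C"
  define p' where "p' r = (if r = length w then call_used k l a X else follow_call k l a X 1 (p r))" for r
  define q' where "q' = follow_call k l a X 1 q"
  have lim: "((\<lambda>u. (G u ** R u) $ i $ j * exp (call_update k l a X $ i $ j * u))
      \<longlongrightarrow> follow_call k l a X (- 1) B $ i $ j) at_top"
    if "\<And>i j. ((\<lambda>u. G u $ i $ j * exp (X $ i $ j * u)) \<longlongrightarrow> B $ i $ j) at_top" for G B i j
    using rotation_limit[OF kl a ties c1 that] by (simp add: R_def s_def)
  have M'lim: "((\<lambda>u. M' u $ i $ j * exp (call_update k l a X $ i $ j * u)) \<longlongrightarrow> C' $ i $ j) at_top" for i j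
    unfolding M'_def C'_def by (rule lim[OF M])
  have "C' $ i $ j \<noteq> 0" for i j using C by (simp add: C'_def follow_call_def)
  moreover have "\<exists>K. transpose K = - K \<and> D' r u = M' u ** K" if "r < length (z # w)" "u > 0" for r u
  proof (cases "r = length w")
    case True
    have "transpose (J u) = - J u"
      using kl by (auto simp: J_def infinitesimal_rotation_def transpose_def vec_eq_iff)
    then show ?thesis using True by (auto simp: D'_def)
  next
    case False
    then obtain K' where "transpose K' = - K'" "D r u = M u ** K'" using K[of r u] \<open>r < length (z # w)\<close> \<open>u > 0\<close> by auto
    then show ?thesis using skew_tangent_rotation[OF orth[OF \<open>u > 0\<close>], of K' "M u"] False by (simp add: D'_def M'_def)
  qed
  moreover have "((\<lambda>u. D' r u $ i $ j * exp (call_update k l a X $ i $ j * u)) \<longlongrightarrow> C' $ i $ j * p' r $ i $ j) at_top"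
    if "r < length (z # w)" for r i j
  proof (cases "r = length w")
    case True
    show ?thesis
      using new_tangent_limit[OF kl a ties M'lim[unfolded C'_def], of i j]
      by (simp add: True D'_def p'_def C'_def J_def s_def)
  next
    case False
    then have "r < length w" using that by simp
    then have "((\<lambda>u. D r u $ i $ j * exp (X $ i $ j * u)) \<longlongrightarrow> (\<chi> i j. C $ i $ j * p r $ i $ j) $ i $ j) at_top" for i j
      using D[of r i j] by simp
    note lim[OF this, of i j]
    \<comment> \<open>The sign belongs to \<open>C\<close> alone: the product is followed with
      \<open>- 1\<close> by following \<open>C\<close> with \<open>- 1\<close> and
      \<open>p r\<close> with \<open>1\<close>.\<close>
    moreover have "follow_call k l a X (- 1) (\<chi> i j. C $ i $ j * p r $ i $ j) $ i $ j = C' $ i $ j * p' r $ i $ j"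
      using False by (auto simp: p'_def C'_def follow_call_def)
    moreover have "D' r u = D r u ** R u" for u using False by (simp add: D'_def)
    ultimately show ?thesis by (simp only:)
  qed
  moreover have "call_update k l a X = (\<Sum>r<length (z # w). \<theta> r *\<^sub>R p' r) + b *\<^sub>R q'"
  proof -
    have "call_update k l a X = follow_call k l a X 1 ((\<Sum>r<length w. \<theta> r *\<^sub>R p r) + b *\<^sub>R q) + a *\<^sub>R call_used k l a X"
      using call_update_eq_follow[OF kl, of a X] by (simp add: Xeq[symmetric])
    also have "\<dots> = (\<Sum>r<length w. \<theta> r *\<^sub>R p' r) + b *\<^sub>R q' + \<theta> (length w) *\<^sub>R p' (length w)"
      by (simp add: follow_call_linear p'_def q'_def a_def)
    finally show ?thesis by (simp add: add_ac)
  qed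
  moreover have "p' r $ i $ j \<in> {0, 1}" "q' $ i $ j \<in> {0, 1}" for r i j
    using p01 q01 by (auto simp: p'_def q'_def follow_call_def call_used_def)
  ultimately show ?case unfolding X' using M'lim
    by (intro exI[of _ M'] exI[of _ D'] exI[of _ C'] exI[of _ p'] exI[of _ q']) auto
qed

theorem generic_params_rank:
  fixes w :: "('n::finite \<times> 'n) list"
  assumes "generic_params b w \<theta>" "\<forall>p\<in>set w. fst p \<noteq> snd p"
  shows "\<exists>p q. calls (uniform_matrix b) (with_params w \<theta>) = (\<Sum>r<length w. \<theta> r *\<^sub>R p r) + b *\<^sub>R q \<and>
    (\<forall>r i j. p r $ i $ j \<in> {0, 1 :: real}) \<and> (\<forall>i j. q $ i $ j \<in> {0, 1 :: real}) \<and>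
    dim (p ` {..<length w}) \<le> CARD('n) choose 2"
proof -
  let ?X = "calls (uniform_matrix b) (with_params w \<theta>)" and ?I = "{..<length w}"
  obtain M D C p q where
    "\<forall>i j. C $ i $ j \<noteq> 0"
    "\<forall>r<length w. \<forall>u>0. \<exists>K. transpose K = - K \<and> D r u = M u ** K"
    "\<forall>r<length w. \<forall>i j. ((\<lambda>u. D r u $ i $ j * exp (?X $ i $ j * u)) \<longlongrightarrow> C $ i $ j * p r $ i $ j) at_top"
    and X: "?X = (\<Sum>r<length w. \<theta> r *\<^sub>R p r) + b *\<^sub>R q"
    and p01: "\<forall>r i j. p r $ i $ j \<in> {0, 1}" and q01: "\<forall>i j. q $ i $ j \<in> {0, 1}"
    using generic_params_structure[OF assms] by (elim exE conjE) (rule that)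
  note C = this(1)[rule_format] and K = this(2)[rule_format] and D = this(3)[rule_format]
  \<comment> \<open>Scaling the entries by exponentials, and later dividing them by
    \<open>C\<close>, is linear on matrices and cannot raise the dimension of a span.\<close>
  define E where "E u r = ((\<chi> i j. D r u $ i $ j * exp (?X $ i $ j * u)) :: real ^ 'n ^ 'n)" for u r
  define E0 where "E0 r = ((\<chi> i j. C $ i $ j * p r $ i $ j) :: real ^ 'n ^ 'n)" for r
  have "dim (E0 ` ?I) \<le> CARD('n) choose 2"
  proof (rule dim_image_limit_le[where v = E])
    show "((\<lambda>u. E u r) \<longlongrightarrow> E0 r) at_top" if "r \<in> ?I" for r
      unfolding E_def E0_def using D that by (intro tendsto_vec_lambda) auto
    have "dim (E u ` ?I) \<le> CARD('n) choose 2" if "u > 0" for u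
    proof -
      define L where "L K = ((\<chi> i j. (M u ** K) $ i $ j * exp (?X $ i $ j * u)) :: real ^ 'n ^ 'n)" for K
      have "linear L"
        by (rule linearI) (simp_all add: L_def vec_eq_iff matrix_matrix_mult_def sum.distrib sum_distrib_left
            sum_distrib_right distrib_left distrib_right mult_ac)
      have "E u ` ?I \<subseteq> L ` {K. transpose K = - K}"
      proof (rule image_subsetI)
        fix r assume "r \<in> ?I"
        then obtain K' where "transpose K' = - K'" "D r u = M u ** K'" using K \<open>u > 0\<close> by blast
        then show "E u r \<in> L ` {K. transpose K = - K}" by (auto simp: E_def L_def)
      qed
      then have "dim (E u ` ?I) \<le> dim (L ` {K. transpose K = - K})" by (rule dim_subset)
      also have "\<dots> \<le> dim {K :: real ^ 'n ^ 'n. transpose K = - K}" by (rule dim_image_le[OF \<open>linear L\<close>])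
      also have "\<dots> \<le> CARD('n) choose 2" by (rule dim_skew_symmetric_le)
      finally show ?thesis .
    qed
    then show "\<forall>\<^sub>F u in at_top. dim (E u ` ?I) \<le> CARD('n) choose 2"
      by (intro eventually_mono[OF eventually_gt_at_top[of "0::real"]])
  qed
  moreover have "dim (p ` ?I) \<le> dim (E0 ` ?I)"
  proof -
    define L where "L A = ((\<chi> i j. A $ i $ j / C $ i $ j) :: real ^ 'n ^ 'n)" for A
    have "linear L" by (rule linearI) (simp_all add: L_def vec_eq_iff add_divide_distrib)
    moreover have "p ` ?I = L ` (E0 ` ?I)"
      unfolding image_image by (intro image_cong) (simp_all add: L_def E0_def C vec_eq_iff)
    ultimately show ?thesis using dim_image_le by metis
  qed
  ultimately show ?thesis using X p01 q01 by (intro exI[of _ p] exI[of _ q]) auto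
qed

section \<open>Density of generic losses\<close>

lemma with_params_cong:
  "(\<And>r. r < length w \<Longrightarrow> \<theta> r = \<eta> r) \<Longrightarrow> with_params w \<theta> = with_params w \<eta>"
  by (induction w) auto

lemma generic_params_cong:
  "(\<And>r. r < length w \<Longrightarrow> \<theta> r = \<eta> r) \<Longrightarrow> generic_params b w \<theta> = generic_params b w \<eta>"
  by (induction w) (auto cong: with_params_cong)

lemma generic_params_dense:
  fixes w :: "('n::finite \<times> 'n) list"
  assumes "0 < \<epsilon>" "\<And>r. r < length w \<Longrightarrow> 0 \<le> \<theta> r"
  shows "\<exists>\<eta>. generic_params b w \<eta> \<and> (\<forall>r<length w. 0 < \<eta> r \<and> \<bar>\<eta> r - \<theta> r\<bar> < \<epsilon>)"
  using assms(2)
proof (induction w)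
  case (Cons z w)
  then obtain \<eta> where \<eta>: "generic_params b w \<eta>" "\<forall>r<length w. 0 < \<eta> r \<and> \<bar>\<eta> r - \<theta> r\<bar> < \<epsilon>" by auto
  let ?X = "calls (uniform_matrix b) (with_params w \<eta>)" and ?n = "length w"
  let ?T = "range (\<lambda>i. \<bar>?X $ i $ fst z - ?X $ i $ snd z\<bar>)"
  \<comment> \<open>Once the earlier losses are fixed, only the finitely many values in
    \<open>?T\<close> are forbidden for the last. Choosing it above \<open>\<theta>\<close> keeps it
    positive.\<close>
  have "infinite {\<theta> ?n <..< \<theta> ?n + \<epsilon>}" using assms(1) by (intro infinite_Ioo) simp
  then have "infinite ({\<theta> ?n <..< \<theta> ?n + \<epsilon>} - ?T)" by simp
  from infinite_imp_nonempty[OF this] obtain a where a: "a \<in> {\<theta> ?n <..< \<theta> ?n + \<epsilon>} - ?T" by blast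
  have nn: "0 \<le> \<theta> ?n" using Cons.prems by simp
  let ?\<eta> = "\<eta>(?n := a)"
  have eq: "with_params w ?\<eta> = with_params w \<eta>" "generic_params b w ?\<eta> = generic_params b w \<eta>"
    by (intro with_params_cong generic_params_cong; simp)+
  have "generic_params b (z # w) ?\<eta>" using \<eta>(1) a nn unfolding generic_params.simps eq by auto
  moreover have "\<forall>r<length (z # w). 0 < ?\<eta> r \<and> \<bar>?\<eta> r - \<theta> r\<bar> < \<epsilon>"
    using \<eta>(2) a nn by (auto simp: less_Suc_eq)
  ultimately show ?case by blast
qed simp

lemma tendsto_calls:
  fixes \<theta>s :: "nat \<Rightarrow> nat \<Rightarrow> real" and X :: "real ^ 'n::finite ^ 'n"
  assumes "\<And>r. r < length w \<Longrightarrow> (\<lambda>m. \<theta>s m r) \<longlonglongrightarrow> \<theta> r"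
  shows "(\<lambda>m. calls X (with_params w (\<theta>s m)) $ i $ j) \<longlonglongrightarrow> calls X (with_params w \<theta>) $ i $ j"
  using assms
proof (induction w arbitrary: i j)
  case (Cons z w)
  have IH: "(\<lambda>m. calls X (with_params w (\<theta>s m)) $ i $ j) \<longlonglongrightarrow> calls X (with_params w \<theta>) $ i $ j" for i j
    using Cons by simp
  have lim: "(\<lambda>m. \<theta>s m (length w)) \<longlonglongrightarrow> \<theta> (length w)" using Cons.prems by simp
  consider "j = fst z" | "j \<noteq> fst z" "j = snd z" | "j \<noteq> fst z" "j \<noteq> snd z" by blast
  then show ?case
    by cases (simp_all add: call_update_def tendsto_intros IH lim)
qed simp

lemma ex_with_params:
  "\<exists>\<theta>. cs = with_params (map (\<lambda>c. (fst c, fst (snd c))) cs) \<theta> \<and> (\<forall>r<length cs. \<theta> r \<in> (snd \<circ> snd) ` set cs)"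
proof (induction cs)
  case (Cons c cs)
  let ?w = "map (\<lambda>c. (fst c, fst (snd c))) cs"
  obtain \<theta> where \<theta>: "cs = with_params ?w \<theta>" "\<forall>r<length cs. \<theta> r \<in> (snd \<circ> snd) ` set cs"
    using Cons by blast
  let ?\<theta> = "\<theta>(length cs := snd (snd c))"
  have "with_params ?w ?\<theta> = with_params ?w \<theta>" by (intro with_params_cong) simp
  then have "with_params ?w ?\<theta> = cs" by (rule trans[OF _ \<theta>(1)[symmetric]])
  then have "c # cs = with_params (map (\<lambda>c. (fst c, fst (snd c))) (c # cs)) ?\<theta>" by simp
  moreover have "\<forall>r<length (c # cs). ?\<theta> r \<in> (snd \<circ> snd) ` set (c # cs)" using \<theta>(2) by (auto simp: less_Suc_eq)
  ultimately show ?case by blast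
qed simp

lemma set_with_params: "set (with_params w \<theta>) \<subseteq> {(k, l, \<theta> r) |k l r. (k, l) \<in> set w \<and> r < length w}"
  by (induction w) (fastforce simp: less_Suc_eq)+

section \<open>Confining the products to finitely many subspaces\<close>

text \<open>The inequality \<open>X $ i $ j < b\<close> is strict so that it persists for nearby
  generic losses; the length bound leaves finitely many words.\<close>

theorem metric_products_parametrized:
  fixes X :: "real ^ 'n::finite ^ 'n"
  assumes "X \<in> metric_products"
  shows "\<exists>w b \<theta>. set w \<subseteq> {(k, l). k \<noteq> l} \<and> length w \<le> CARD('n) ^ 3 \<and> (\<forall>i j. X $ i $ j < b) \<and>
    (\<forall>r<length w. 0 \<le> \<theta> r) \<and> X = calls (uniform_matrix b) (with_params w \<theta>)"
proof -
  have X: "\<And>i j. 0 \<le> X $ i $ j" "ennreal_matrix X \<in> lossy_gossip_monoid"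
    using assms by (auto simp: metric_products_eq_finite_part)
  obtain cs where cs: "proper_calls cs" "\<forall>c\<in>set cs. 0 \<le> snd (snd c)" "length cs \<le> CARD('n) ^ 3"
    "ennreal_matrix X = calls trop_one (map (\<lambda>(k, l, a). (k, l, ennreal a)) cs)"
    using lossy_gossip_monoid_finite_calls[OF X(2)] by auto
  obtain b where b: "\<And>i j. X $ i $ j < b"
  proof
    show "X $ i $ j < 1 + norm X" for i j
      using component_le_norm_cart[of "X $ i" j] Finite_Cartesian_Product.norm_nth_le[of X i] by simp
  qed
  have "0 \<le> b" using X(1) b by (meson less_imp_le order_trans)
  have eq: "calls (uniform_matrix b) cs = X" by (rule calls_uniform_eq[OF cs(2,4) X(1) b \<open>0 \<le> b\<close>])
  define w where "w = map (\<lambda>c. (fst c, fst (snd c))) cs"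
  obtain \<theta> where \<theta>: "cs = with_params w \<theta>" "\<forall>r<length cs. \<theta> r \<in> (snd \<circ> snd) ` set cs"
    using ex_with_params unfolding w_def by blast
  show ?thesis
  proof (intro exI conjI allI impI)
    show "set w \<subseteq> {(k, l). k \<noteq> l}" "length w \<le> CARD('n) ^ 3" using cs(1,3) by (auto simp: w_def)
    show "X $ i $ j < b" for i j by (rule b)
    show "X = calls (uniform_matrix b) (with_params w \<theta>)" using eq unfolding \<theta>(1)[symmetric] by (rule sym)
    fix r assume "r < length w"
    then have "\<theta> r \<in> (snd \<circ> snd) ` set cs" using \<theta>(2) by (simp add: w_def)
    then show "0 \<le> \<theta> r" using cs(2) by auto
  qed
qed

lemma parametrized_metric_products:
  fixes w :: "('n::finite \<times> 'n) list"
  assumes "set w \<subseteq> {(k, l). k \<noteq> l}" "0 \<le> b" "\<And>r. r < length w \<Longrightarrow> 0 \<le> \<theta> r"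
  shows "calls (uniform_matrix b) (with_params w \<theta>) \<in> metric_products"
proof (rule calls_uniform_in_metric_products[OF assms(2)])
  have *: "fst c \<noteq> fst (snd c) \<and> 0 \<le> snd (snd c)" if c: "c \<in> set (with_params w \<theta>)" for c
  proof -
    obtain k l r where "c = (k, l, \<theta> r)" "(k, l) \<in> set w" "r < length w"
      using subsetD[OF set_with_params c] by blast
    then show ?thesis using assms(1,3) by auto
  qed
  show "proper_calls (with_params w \<theta>)" "\<forall>c\<in>set (with_params w \<theta>). 0 \<le> snd (snd c)"
    using * by blast+
qed

lemma finite_zero_one_matrices: "finite {Z :: real ^ 'n::finite ^ 'n. \<forall>i j. Z $ i $ j \<in> {0, 1}}"
proof -
  have "{Z :: real ^ 'n ^ 'n. \<forall>i j. Z $ i $ j \<in> {0, 1}} \<subseteq> (\<lambda>S. \<chi> i j. if (i, j) \<in> S then 1 else 0) ` UNIV"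
  proof
    fix Z :: "real ^ 'n ^ 'n" assume "Z \<in> {Z. \<forall>i j. Z $ i $ j \<in> {0, 1}}"
    then have "Z = (\<chi> i j. if (i, j) \<in> {(i, j). Z $ i $ j = 1} then 1 else 0)" by (auto simp: vec_eq_iff)
    then show "Z \<in> (\<lambda>S. \<chi> i j. if (i, j) \<in> S then 1 else 0) ` UNIV" by blast
  qed
  then show ?thesis by (rule finite_subset) simp
qed

theorem metric_products_low_dim:
  "(metric_products :: (real ^ 'n::finite ^ 'n) set) \<subseteq>
    \<Union>(span ` {W. W \<subseteq> {Z. \<forall>i j. Z $ i $ j \<in> {0, 1}} \<and> dim W \<le> CARD('n) choose 2})"
  (is "_ \<subseteq> \<Union>(span ` ?\<W>)")
proof
  fix X :: "real ^ 'n ^ 'n" assume "X \<in> metric_products"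
  from metric_products_parametrized[OF this] obtain w b \<theta> where w: "set w \<subseteq> {(k, l). k \<noteq> l}"
    and b: "\<forall>i j. X $ i $ j < b" and \<theta>: "\<forall>r<length w. 0 \<le> \<theta> r"
    and X: "X = calls (uniform_matrix b) (with_params w \<theta>)"
    by (elim exE conjE) (rule that)
  have "\<exists>\<eta>. generic_params b w \<eta> \<and> (\<forall>r<length w. 0 < \<eta> r \<and> \<bar>\<eta> r - \<theta> r\<bar> < 1 / real (Suc m))" for m
    by (rule generic_params_dense) (auto simp: \<theta>)
  then obtain \<eta> where \<eta>: "\<And>m. generic_params b w (\<eta> m)"
    "\<And>m r. r < length w \<Longrightarrow> 0 < \<eta> m r \<and> \<bar>\<eta> m r - \<theta> r\<bar> < 1 / real (Suc m)"
    using choice[of "\<lambda>m \<eta>. generic_params b w \<eta> \<and> (\<forall>r<length w. 0 < \<eta> r \<and> \<bar>\<eta> r - \<theta> r\<bar> < 1 / real (Suc m))"]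
    by blast
  define Y where "Y m = calls (uniform_matrix b) (with_params w (\<eta> m))" for m
  have "(\<lambda>m. \<eta> m r) \<longlonglongrightarrow> \<theta> r" if "r < length w" for r
  proof (rule LIMSEQ_I)
    fix e :: real assume "e > 0"
    then obtain N where N: "1 / real (Suc N) < e" using nat_approx_posE by blast
    have "norm (\<eta> m r - \<theta> r) < e" if "m \<ge> N" for m
    proof -
      have "1 / real (Suc m) \<le> 1 / real (Suc N)" using that by (simp add: frac_le)
      then show ?thesis using \<eta>(2)[OF \<open>r < length w\<close>, of m] N by simp
    qed
    then show "\<exists>N. \<forall>m\<ge>N. norm (\<eta> m r - \<theta> r) < e" by blast
  qed
  then have lim: "(\<lambda>m. Y m $ i $ j) \<longlonglongrightarrow> X $ i $ j" for i j unfolding Y_def X by (rule tendsto_calls)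
  have "\<forall>\<^sub>F m in sequentially. \<forall>i\<in>UNIV. \<forall>j\<in>UNIV. Y m $ i $ j < b"
    using lim b by (intro eventually_ball_finite ballI order_tendstoD(2)) auto
  then have "\<forall>\<^sub>F m in sequentially. Y m \<in> \<Union>(span ` ?\<W>)"
  proof eventually_elim
    fix m assume lt: "\<forall>i\<in>UNIV. \<forall>j\<in>UNIV. Y m $ i $ j < b"
    have "\<forall>p\<in>set w. fst p \<noteq> snd p" using w by auto
    from generic_params_rank[OF \<eta>(1)[of m] this, folded Y_def] obtain p q where
      pq: "Y m = (\<Sum>r<length w. \<eta> m r *\<^sub>R p r) + b *\<^sub>R q" "\<forall>r i j. p r $ i $ j \<in> {0, 1}"
        "\<forall>i j. q $ i $ j \<in> {0, 1}" "dim (p ` {..<length w}) \<le> CARD('n) choose 2"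
      by (elim exE conjE) (rule that)
    \<comment> \<open>A coefficient \<open>1\<close> of \<open>b\<close> would make the entry at
      least \<open>b\<close>, as losses are positive.\<close>
    have "q $ i $ j = 0" for i j
    proof (rule ccontr)
      assume "q $ i $ j \<noteq> 0"
      then have "q $ i $ j = 1" using pq(3) by blast
      then have "Y m $ i $ j = (\<Sum>r<length w. \<eta> m r * p r $ i $ j) + b" by (simp add: pq(1))
      moreover have "0 \<le> (\<Sum>r<length w. \<eta> m r * p r $ i $ j)"
      proof (intro sum_nonneg mult_nonneg_nonneg)
        fix r assume "r \<in> {..<length w}"
        then show "0 \<le> \<eta> m r" using \<eta>(2)[of r m] by simp
        show "0 \<le> p r $ i $ j" using pq(2)[rule_format, of r i j] by auto
      qed
      moreover have "Y m $ i $ j < b" using lt by simp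
      ultimately show False by linarith
    qed
    then have "q = 0" by (simp add: vec_eq_iff)
    then have "Y m = (\<Sum>r<length w. \<eta> m r *\<^sub>R p r)" by (simp add: pq(1))
    also have "\<dots> \<in> span (p ` {..<length w})" by (intro span_sum span_scale span_base) auto
    finally have "Y m \<in> span (p ` {..<length w})" .
    moreover have "p ` {..<length w} \<in> ?\<W>" using pq(2,4) by auto
    ultimately show "Y m \<in> \<Union>(span ` ?\<W>)" by blast
  qed
  moreover have "closed (\<Union>(span ` ?\<W>))"
  proof (intro closed_Union finite_imageI ballI)
    show "finite ?\<W>"
      by (rule finite_subset[OF _ finite_Pow_iff[THEN iffD2, OF finite_zero_one_matrices]]) blast
    fix H assume "H \<in> span ` ?\<W>"
    then show "closed H" using closed_span by auto
  qed
  moreover have "Y \<longlonglongrightarrow> X" using lim by (intro vec_tendstoI)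
  ultimately show "X \<in> \<Union>(span ` ?\<W>)"
    using Lim_in_closed_set[OF _ _ sequentially_bot] by blast
qed

section \<open>The fan\<close>

text \<open>Coefficients of differences of two forms with coefficients \<open>0\<close> and
  \<open>1\<close>, the forms compared by a minimum. Vanishing from \<open>K\<close> on makes the
  set finite.\<close>

definition small_coefficients :: "nat \<Rightarrow> (nat \<Rightarrow> real) set" where
  "small_coefficients K = {\<beta>. \<forall>r. (r \<in> {..<K} \<longrightarrow> \<beta> r \<in> {- 1, 0, 1}) \<and> (r \<notin> {..<K} \<longrightarrow> \<beta> r = 0)}"

lemma finite_small_coefficients: "finite (small_coefficients K)"
  unfolding small_coefficients_def by (rule finite_set_of_finite_funs) auto

lemma same_min:
  fixes x x' y y' :: real
  assumes "sgn (x - y) = sgn (x' - y')"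
  shows "min x y = x \<and> min x' y' = x' \<or> min x y = y \<and> min x' y' = y'"
  using assms by (auto simp: min_def sgn_if split: if_splits)

text \<open>Index \<open>N\<close> holds the constant \<open>b\<close>, the indices below
  \<open>length w\<close> the losses. Each minimum compares two forms with coefficients
  \<open>0\<close> and \<open>1\<close>, so equal signs of all differences make both parameter
  vectors take the same branch throughout.\<close>

lemma calls_linear_on_sign_class:
  fixes w :: "('n::finite \<times> 'n) list"
  assumes sgn: "\<And>\<beta>. \<beta> \<in> small_coefficients (Suc N) \<Longrightarrow>
      sgn (\<Sum>r<Suc N. \<beta> r * \<theta> r) = sgn (\<Sum>r<Suc N. \<beta> r * \<eta> r)"
    and "length w \<le> N"
  shows "\<exists>\<beta>. (\<forall>r. \<beta> r \<in> {0, 1}) \<and> (\<forall>r. length w \<le> r \<and> r \<noteq> N \<longrightarrow> \<beta> r = 0) \<and>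
    calls (uniform_matrix (\<theta> N)) (with_params w \<theta>) $ i $ j = (\<Sum>r<Suc N. \<beta> r * \<theta> r) \<and>
    calls (uniform_matrix (\<eta> N)) (with_params w \<eta>) $ i $ j = (\<Sum>r<Suc N. \<beta> r * \<eta> r)"
  using assms(2)
proof (induction w arbitrary: j)
  case Nil
  let ?\<beta> = "\<lambda>r. if r = N \<and> i \<noteq> j then 1 else 0 :: real"
  have "(\<Sum>r<Suc N. ?\<beta> r * \<zeta> r) = (if i = j then 0 else \<zeta> N)" for \<zeta> :: "nat \<Rightarrow> real"
    by simp
  then show ?case by (intro exI[of _ ?\<beta>]) (auto simp: uniform_matrix_def simp del: sum.lessThan_Suc)
next
  case (Cons z w)
  let ?n = "length w"
  let ?X = "\<lambda>\<zeta>. calls (uniform_matrix (\<zeta> N)) (with_params w \<zeta>)"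
  let ?S = "\<lambda>\<beta> \<zeta>. \<Sum>r<Suc N. \<beta> r * \<zeta> r :: real"
  let ?good = "\<lambda>m \<beta>. (\<forall>r. \<beta> r \<in> {0, 1 :: real}) \<and> (\<forall>r. m \<le> r \<and> r \<noteq> N \<longrightarrow> \<beta> r = 0)"
  have IH: "\<exists>\<beta>. ?good ?n \<beta> \<and> ?X \<theta> $ i $ j = ?S \<beta> \<theta> \<and> ?X \<eta> $ i $ j = ?S \<beta> \<eta>" for j
    using Cons.IH[of j] Cons.prems by (simp del: sum.lessThan_Suc)
  have step: "\<exists>\<beta>. ?good (Suc ?n) \<beta> \<and> min (?X \<theta> $ i $ k) (?X \<theta> $ i $ l + \<theta> ?n) = ?S \<beta> \<theta> \<and>
      min (?X \<eta> $ i $ k) (?X \<eta> $ i $ l + \<eta> ?n) = ?S \<beta> \<eta>" for k l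
  proof -
    obtain \<beta> where \<beta>: "?good ?n \<beta>" "?X \<theta> $ i $ k = ?S \<beta> \<theta>" "?X \<eta> $ i $ k = ?S \<beta> \<eta>" using IH by blast
    obtain \<gamma> where \<gamma>: "?good ?n \<gamma>" "?X \<theta> $ i $ l = ?S \<gamma> \<theta>" "?X \<eta> $ i $ l = ?S \<gamma> \<eta>" using IH by blast
    \<comment> \<open>The new loss has not occurred before, so its coefficient rises from
      \<open>0\<close> to \<open>1\<close>.\<close>
    let ?\<gamma> = "\<gamma>(?n := 1)"
    have n: "?n < N" using Cons.prems by simp
    have upd: "?S ?\<gamma> \<zeta> = ?S \<gamma> \<zeta> + \<zeta> ?n" for \<zeta>
    proof -
      have "?S ?\<gamma> \<zeta> = (\<Sum>r<Suc N. \<gamma> r * \<zeta> r + (if r = ?n then \<zeta> r else 0))"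
        using \<gamma>(1) n by (intro sum.cong) auto
      also have "\<dots> = ?S \<gamma> \<zeta> + (\<Sum>r<Suc N. if r = ?n then \<zeta> r else 0)" by (rule sum.distrib)
      also have "(\<Sum>r<Suc N. if r = ?n then \<zeta> r else 0) = \<zeta> ?n"
        using n by (subst sum.delta) auto
      finally show ?thesis .
    qed
    have diff: "?S (\<lambda>r. \<beta> r - ?\<gamma> r) \<zeta> = ?S \<beta> \<zeta> - ?S ?\<gamma> \<zeta>" for \<zeta>
      unfolding sum_subtractf[symmetric] by (simp only: left_diff_distrib)
    have g: "?good (Suc ?n) \<beta>" "?good (Suc ?n) ?\<gamma>" using \<beta>(1) \<gamma>(1) by auto
    have "(\<lambda>r. \<beta> r - ?\<gamma> r) \<in> small_coefficients (Suc N)"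
      unfolding small_coefficients_def
    proof (intro CollectI allI conjI impI)
      fix r
      have "\<beta> r \<in> {0, 1}" "?\<gamma> r \<in> {0, 1}" using g by blast+
      then show "\<beta> r - ?\<gamma> r \<in> {- 1, 0, 1}" by auto
      assume "r \<notin> {..<Suc N}"
      then have "Suc ?n \<le> r \<and> r \<noteq> N" using n by auto
      then have "\<beta> r = 0" "?\<gamma> r = 0" using g by blast+
      then show "\<beta> r - ?\<gamma> r = 0" by simp
    qed
    from sgn[OF this] have "sgn (?S \<beta> \<theta> - ?S ?\<gamma> \<theta>) = sgn (?S \<beta> \<eta> - ?S ?\<gamma> \<eta>)" unfolding diff .
    from same_min[OF this] show ?thesis
      unfolding \<beta>(2,3) \<gamma>(2,3) upd[symmetric] using g by blast
  qed
  consider "j = fst z" | "j \<noteq> fst z" "j = snd z" | "j \<noteq> fst z" "j \<noteq> snd z" by blast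
  then show ?case
  proof cases
    case 1
    then show ?thesis using step[of "fst z" "snd z"] by (simp add: call_update_def del: sum.lessThan_Suc)
  next
    case 2
    then show ?thesis using step[of "snd z" "fst z"] by (simp add: call_update_def del: sum.lessThan_Suc)
  next
    case 3
    obtain \<beta> where "?good ?n \<beta>" "?X \<theta> $ i $ j = ?S \<beta> \<theta>" "?X \<eta> $ i $ j = ?S \<beta> \<eta>" using IH by blast
    then show ?thesis using 3
      by (intro exI[of _ \<beta>]) (simp add: call_update_def del: sum.lessThan_Suc)
  qed
qed

lemma sign_determined_calls:
  fixes w :: "('n::finite \<times> 'n) list"
  shows "\<exists>A. finite A \<and> sign_determined (Suc (length w)) A (\<lambda>(X :: real ^ 'n ^ 'n) \<theta>.
    (\<forall>r\<le>length w. 0 \<le> \<theta> r) \<and> X = calls (uniform_matrix (\<theta> (length w))) (with_params w \<theta>))"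
proof (intro exI conjI)
  let ?N = "length w"
  \<comment> \<open>The matrix \<open>0\<close> yields forms in the parameters alone, which decide
    minima and nonnegativity; unit matrices yield forms comparing an entry of \<open>X\<close> with
    its linear expression.\<close>
  let ?E = "insert 0 (range (\<lambda>(i, j). axis i (axis j 1))) :: (real ^ 'n ^ 'n) set"
  let ?A = "?E \<times> small_coefficients (Suc ?N)"
  let ?S = "\<lambda>\<beta> \<zeta>. \<Sum>r<Suc ?N. \<beta> r * \<zeta> r :: real"
  show "finite ?A" using finite_small_coefficients by simp
  show "sign_determined (Suc ?N) ?A (\<lambda>(X :: real ^ 'n ^ 'n) \<theta>.
    (\<forall>r\<le>?N. 0 \<le> \<theta> r) \<and> X = calls (uniform_matrix (\<theta> ?N)) (with_params w \<theta>))"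
    unfolding sign_determined_def
  proof (intro allI impI, elim conjE, intro conjI allI impI)
    fix X Y :: "real ^ 'n ^ 'n" and \<theta> \<eta> :: "nat \<Rightarrow> real"
    assume eq: "\<forall>f\<in>?A. sgn (affine_form (Suc ?N) f X \<theta>) = sgn (affine_form (Suc ?N) f Y \<eta>)"
      and \<theta>: "\<forall>r\<le>?N. 0 \<le> \<theta> r" and X: "X = calls (uniform_matrix (\<theta> ?N)) (with_params w \<theta>)"
    have sgn: "sgn (?S \<beta> \<theta>) = sgn (?S \<beta> \<eta>)" if "\<beta> \<in> small_coefficients (Suc ?N)" for \<beta>
    proof -
      have "(0, \<beta>) \<in> ?A" using that by simp
      from bspec[OF eq this] show ?thesis unfolding affine_form_def by simp
    qed
    show "0 \<le> \<eta> r" if r: "r \<le> ?N" for r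
    proof -
      let ?\<beta> = "\<lambda>q. if q = r then 1 else 0 :: real"
      have delta: "?S ?\<beta> \<zeta> = \<zeta> r" for \<zeta>
      proof -
        have "?S ?\<beta> \<zeta> = (\<Sum>q<Suc ?N. if q = r then \<zeta> q else 0)" by (intro sum.cong) auto
        also have "\<dots> = \<zeta> r" using r by (subst sum.delta) auto
        finally show ?thesis .
      qed
      have "?\<beta> \<in> small_coefficients (Suc ?N)" using r by (auto simp: small_coefficients_def)
      from sgn[OF this] have "sgn (\<theta> r) = sgn (\<eta> r)" unfolding delta .
      moreover have "0 \<le> \<theta> r" using \<theta> r by blast
      ultimately show ?thesis by (simp add: sgn_if split: if_splits)
    qed
    have "Y $ i $ j = calls (uniform_matrix (\<eta> ?N)) (with_params w \<eta>) $ i $ j" for i j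
    proof -
      have "\<exists>\<beta>. (\<forall>r. \<beta> r \<in> {0, 1}) \<and> (\<forall>r. ?N \<le> r \<and> r \<noteq> ?N \<longrightarrow> \<beta> r = 0) \<and>
        calls (uniform_matrix (\<theta> ?N)) (with_params w \<theta>) $ i $ j = ?S \<beta> \<theta> \<and>
        calls (uniform_matrix (\<eta> ?N)) (with_params w \<eta>) $ i $ j = ?S \<beta> \<eta>"
        by (rule calls_linear_on_sign_class[OF _ order_refl]) (rule sgn)
      then obtain \<beta> where \<beta>: "\<forall>r. \<beta> r \<in> {0, 1}" "\<forall>r. ?N \<le> r \<and> r \<noteq> ?N \<longrightarrow> \<beta> r = 0"
        "calls (uniform_matrix (\<theta> ?N)) (with_params w \<theta>) $ i $ j = ?S \<beta> \<theta>"
        "calls (uniform_matrix (\<eta> ?N)) (with_params w \<eta>) $ i $ j = ?S \<beta> \<eta>"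
        by (elim exE conjE) (rule that)
      let ?f = "(axis i (axis j 1) :: real ^ 'n ^ 'n, \<lambda>r. - \<beta> r)"
      have af: "affine_form (Suc ?N) ?f Z \<zeta> = Z $ i $ j - ?S \<beta> \<zeta>" for Z \<zeta>
        unfolding affine_form_def by (simp add: inner_axis' sum_negf del: sum.lessThan_Suc)
      have "- \<beta> r \<in> {- 1, 0, 1}" for r using spec[OF \<beta>(1), of r] by auto
      then have "(\<lambda>r. - \<beta> r) \<in> small_coefficients (Suc ?N)"
        using \<beta>(2) by (auto simp: small_coefficients_def)
      then have "?f \<in> ?A" by auto
      from bspec[OF eq this] have "sgn (X $ i $ j - ?S \<beta> \<theta>) = sgn (Y $ i $ j - ?S \<beta> \<eta>)" unfolding af .
      moreover have "X $ i $ j - ?S \<beta> \<theta> = 0" unfolding \<beta>(3)[symmetric] X by simp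
      ultimately have "Y $ i $ j - ?S \<beta> \<eta> = 0" by (metis sgn_0_0)
      then show ?thesis unfolding \<beta>(4) by simp
    qed
    then show "Y = calls (uniform_matrix (\<eta> ?N)) (with_params w \<eta>)" by (simp add: vec_eq_iff)
  qed
qed

theorem metric_products_sign_determined:
  "\<exists>A. finite A \<and> (\<forall>X\<in>metric_products. \<forall>Y :: real ^ 'n::finite ^ 'n.
    (\<forall>a\<in>A. sgn (a \<bullet> X) = sgn (a \<bullet> Y)) \<longrightarrow> Y \<in> metric_products)"
proof -
  let ?W = "{w :: ('n \<times> 'n) list. set w \<subseteq> {(k, l). k \<noteq> l} \<and> length w \<le> CARD('n) ^ 3}"
  define P where "P w X \<theta> \<longleftrightarrow> (\<forall>r\<le>length w. 0 \<le> \<theta> r) \<and>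
    X = calls (uniform_matrix (\<theta> (length w))) (with_params w \<theta>)"
    for w and X :: "real ^ 'n ^ 'n" and \<theta>
  have fin: "finite ?W" by (rule finite_lists_length_le) simp
  have "\<exists>B. finite B \<and> (\<forall>X Y. (\<forall>a\<in>B. sgn (a \<bullet> X) = sgn (a \<bullet> Y)) \<longrightarrow> (\<exists>\<theta>. P w X \<theta>) \<longrightarrow> (\<exists>\<theta>. P w Y \<theta>))" for w
  proof -
    have "P w = (\<lambda>X \<theta>. (\<forall>r\<le>length w. 0 \<le> \<theta> r) \<and>
        X = calls (uniform_matrix (\<theta> (length w))) (with_params w \<theta>))" by (simp add: P_def fun_eq_iff)
    from sign_determined_calls[of w, folded this] obtain A
      where "finite A" "sign_determined (Suc (length w)) A (P w)" by blast
    then show ?thesis by (rule sign_determined_projection)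
  qed
  from choice[OF allI[OF this]] obtain B where B: "\<forall>w. finite (B w) \<and>
    (\<forall>X Y. (\<forall>a\<in>B w. sgn (a \<bullet> X) = sgn (a \<bullet> Y)) \<longrightarrow> (\<exists>\<theta>. P w X \<theta>) \<longrightarrow> (\<exists>\<theta>. P w Y \<theta>))" ..
  show ?thesis
  proof (intro exI[of _ "\<Union>(B ` ?W)"] conjI ballI allI impI)
    show "finite (\<Union>(B ` ?W))" using fin B by (intro finite_UN_I) simp_all
    fix X Y :: "real ^ 'n ^ 'n"
    assume "X \<in> metric_products" and eq: "\<forall>a\<in>\<Union>(B ` ?W). sgn (a \<bullet> X) = sgn (a \<bullet> Y)"
    from metric_products_parametrized[OF this(1)] obtain w b \<theta> where
      w: "set w \<subseteq> {(k, l). k \<noteq> l}" "length w \<le> CARD('n) ^ 3"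
      and b: "\<forall>i j. X $ i $ j < b" and \<theta>: "\<forall>r<length w. 0 \<le> \<theta> r"
      and X: "X = calls (uniform_matrix b) (with_params w \<theta>)" by (elim exE conjE) (rule that)
    have "0 \<le> b"
      by (rule order_trans[OF metric_products_nonneg[OF \<open>X \<in> metric_products\<close>] less_imp_le[OF b[rule_format]]])
    \<comment> \<open>The constant \<open>b\<close> becomes one more parameter to eliminate, so the
      resulting forms do not depend on it.\<close>
    let ?\<theta> = "\<theta>(length w := b)"
    have "with_params w ?\<theta> = with_params w \<theta>" by (intro with_params_cong) simp
    then have "X = calls (uniform_matrix (?\<theta> (length w))) (with_params w ?\<theta>)" using X by simp
    moreover have "\<forall>r\<le>length w. 0 \<le> ?\<theta> r" using \<theta> \<open>0 \<le> b\<close> by simp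
    ultimately have "\<exists>\<theta>. P w X \<theta>" unfolding P_def by blast
    moreover have "\<forall>a\<in>B w. sgn (a \<bullet> X) = sgn (a \<bullet> Y)" using eq w by blast
    ultimately have "\<exists>\<theta>. P w Y \<theta>"
      using B[THEN spec[of _ w], THEN conjunct2, THEN spec[of _ X], THEN spec[of _ Y]] by simp
    then obtain \<eta> where "P w Y \<eta>" ..
    then show "Y \<in> metric_products" unfolding P_def using parametrized_metric_products[OF w(1)] by simp
  qed
qed

section \<open>Attaining the dimension\<close>

text \<open>One symmetric unit matrix for each unordered pair; disjoint supports make them
  orthogonal.\<close>

lemma symmetric_hollow_family:
  "\<exists>V :: (real ^ 'n::finite ^ 'n) set. independent V \<and> card V = CARD('n) choose 2 \<and>
    (\<forall>v\<in>V. \<forall>i j. v $ i $ j = v $ j $ i \<and> v $ i $ i = 0)"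
proof -
  define P where "P = {s :: 'n set. s \<subseteq> UNIV \<and> card s = 2}"
  define e :: "'n set \<Rightarrow> real ^ 'n ^ 'n" where "e s = (\<chi> p q. if p \<noteq> q \<and> {p, q} = s then 1 else 0)" for s
  have "\<exists>p q. p \<noteq> q \<and> {p, q} = s" if "s \<in> P" for s using that by (auto simp: P_def card_2_iff)
  then have one: "\<exists>p q. p \<noteq> q \<and> {p, q} = s \<and> e s $ p $ q = 1" if "s \<in> P" for s
    using that by (fastforce simp: e_def)
  have inj: "inj_on e P"
  proof (rule inj_onI)
    fix s t assume "s \<in> P" "t \<in> P" "e s = e t"
    obtain p q where "p \<noteq> q" "{p, q} = s" "e s $ p $ q = 1" using one[OF \<open>s \<in> P\<close>] by blast
    then have "e t $ p $ q = 1" using \<open>e s = e t\<close> by simp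
    then show "s = t" using \<open>{p, q} = s\<close> by (simp add: e_def split: if_splits)
  qed
  have "0 \<notin> e ` P"
  proof
    assume "0 \<in> e ` P"
    then obtain s where "s \<in> P" "e s = 0" by (metis imageE)
    then show False using one[of s] by simp
  qed
  moreover have "pairwise orthogonal (e ` P)"
  proof (rule pairwiseI)
    fix x y assume "x \<in> e ` P" "y \<in> e ` P" "x \<noteq> y"
    then obtain s t where "x = e s" "y = e t" "s \<noteq> t" by blast
    then have "x $ i $ j * y $ i $ j = 0" for i j by (simp add: e_def)
    then show "orthogonal x y" unfolding orthogonal_def inner_vec_def by (simp add: sum.neutral)
  qed
  ultimately have "independent (e ` P)" using pairwise_orthogonal_independent by blast
  moreover have "card (e ` P) = CARD('n) choose 2"
    using card_image[OF inj] n_subsets[of "UNIV :: 'n set" 2] by (simp add: P_def)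
  moreover have "\<forall>v\<in>e ` P. \<forall>i j. v $ i $ j = v $ j $ i \<and> v $ i $ i = 0"
    by (auto simp: e_def insert_commute)
  ultimately show ?thesis by blast
qed

text \<open>Two entries above \<open>1\<close> add up to more than any entry below \<open>2\<close>.
  These strict bounds survive small perturbations, unlike the triangle inequality itself.\<close>

lemma hollow_symmetric_metric:
  assumes "\<forall>i j. X $ i $ j = X $ j $ i \<and> X $ i $ i = 0 \<and> (i \<noteq> j \<longrightarrow> 1 < X $ i $ j \<and> X $ i $ j < 2)"
  shows "X \<in> metric_matrices"
  unfolding metric_matrices_def
proof (intro CollectI conjI allI)
  show "0 \<le> X $ i $ j" for i j using assms by (cases "i = j") (auto simp: less_imp_le order_less_trans[of 0 1])
  show "X $ i $ i = 0" "X $ i $ j = X $ j $ i" for i j using assms by auto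
  fix i j k
  show "X $ i $ k \<le> X $ i $ j + X $ j $ k"
  proof (cases "i = j \<or> j = k")
    case True then show ?thesis using assms by auto
  next
    case False
    then have "1 < X $ i $ j" "1 < X $ j $ k" using assms by auto
    moreover have "X $ i $ k < 2" using assms by (cases "i = k") auto
    ultimately show ?thesis by linarith
  qed
qed

text \<open>Stated for every finite \<open>A\<close>, as the forms of the fan are chosen later. From
  a point of \<open>U\<close> small moves in all directions of \<open>V\<close> stay in
  \<open>U\<close>.\<close>

lemma metric_products_large_cell:
  assumes "finite A"
  shows "\<exists>X\<in>metric_products. int (CARD('n::finite) choose 2) \<le> aff_dim (cell A (X :: real ^ 'n ^ 'n))"
proof -
  obtain V :: "(real ^ 'n ^ 'n) set" where V: "independent V" "card V = CARD('n) choose 2"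
    "\<forall>v\<in>V. \<forall>i j. v $ i $ j = v $ j $ i \<and> v $ i $ i = 0" using symmetric_hollow_family by (elim exE conjE) (rule that)
  define U where "U = {X :: real ^ 'n ^ 'n. \<forall>i j. X $ i $ j = X $ j $ i \<and> X $ i $ i = 0 \<and>
    (i \<noteq> j \<longrightarrow> 1 < X $ i $ j \<and> X $ i $ j < 2)}"
  have "uniform_matrix (3 / 2) \<in> U" by (auto simp: U_def uniform_matrix_def)
  then have "U \<noteq> {}" by blast
  moreover have "\<forall>\<^sub>F e in at_right 0. x + e *\<^sub>R v \<in> U" if x: "x \<in> U" and v: "v \<in> V" for x v
  proof -
    have lim: "((\<lambda>e. x $ i $ j + e * v $ i $ j) \<longlongrightarrow> x $ i $ j + 0 * v $ i $ j) (at_right 0)" for i j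
      by (intro tendsto_intros)
    have "\<forall>\<^sub>F e in at_right 0. \<forall>i\<in>UNIV. \<forall>j\<in>UNIV - {i}. 1 < x $ i $ j + e * v $ i $ j \<and> x $ i $ j + e * v $ i $ j < 2"
    proof (intro eventually_ball_finite ballI eventually_conj)
      fix i j :: 'n assume "j \<in> UNIV - {i}"
      then have "1 < x $ i $ j" "x $ i $ j < 2" using x by (auto simp: U_def)
      then show "\<forall>\<^sub>F e in at_right 0. 1 < x $ i $ j + e * v $ i $ j" "\<forall>\<^sub>F e in at_right 0. x $ i $ j + e * v $ i $ j < 2"
        using order_tendstoD[OF lim[of i j]] by simp_all
    qed auto
    then show ?thesis
    proof eventually_elim
      case (elim e)
      have sym: "x $ i $ j = x $ j $ i" "x $ i $ i = 0" "v $ i $ j = v $ j $ i" "v $ i $ i = 0" for i j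
        using x V(3) v unfolding U_def by blast+
      show ?case unfolding U_def
      proof (intro CollectI allI conjI impI)
        fix i j
        show "(x + e *\<^sub>R v) $ i $ j = (x + e *\<^sub>R v) $ j $ i" using sym(1)[of i j] sym(3)[of i j] by simp
        show "(x + e *\<^sub>R v) $ i $ i = 0" using sym(2,4) by simp
        assume "i \<noteq> j"
        then show "1 < (x + e *\<^sub>R v) $ i $ j" "(x + e *\<^sub>R v) $ i $ j < 2" using elim by auto
      qed
    qed
  qed
  ultimately obtain X where X: "X \<in> U" "int (card V) \<le> aff_dim (cell A X)"
    using cell_of_large_dim[OF assms _ V(1), of U] by blast
  have "X \<in> metric_products" using X(1) unfolding U_def
    by (intro metric_products_base hollow_symmetric_metric) blast
  then show ?thesis using X(2) V(2) by auto
qed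

theorem metric_products_fan:
  "\<exists>F :: (real ^ 'n::finite ^ 'n) set set. finite_polyhedral_fan F \<and>
     \<Union>F = metric_products \<and> fan_dim F = int (CARD('n) choose 2)"
proof -
  let ?S = "metric_products :: (real ^ 'n ^ 'n) set" and ?m = "CARD('n) choose 2"
  let ?\<W> = "{W. W \<subseteq> {Z :: real ^ 'n ^ 'n. \<forall>i j. Z $ i $ j \<in> {0, 1}} \<and> dim W \<le> ?m}"
  have finW: "finite ?\<W>" 
    by (rule finite_subset[OF _ finite_Pow_iff[THEN iffD2, OF finite_zero_one_matrices]]) blast
  obtain A1 where A1: "finite A1"
    "\<forall>X\<in>?S. \<forall>Y. (\<forall>a\<in>A1. sgn (a \<bullet> X) = sgn (a \<bullet> Y)) \<longrightarrow> Y \<in> ?S"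
    using metric_products_sign_determined by (elim exE conjE) (rule that)
  have "\<forall>W :: (real ^ 'n ^ 'n) set. \<exists>B. finite B \<and> (\<forall>y. (\<forall>b\<in>B. b \<bullet> y = 0) \<longleftrightarrow> y \<in> span W)"
    by (intro allI subspace_equations subspace_span)
  from choice[OF this] obtain B :: "(real ^ 'n ^ 'n) set \<Rightarrow> (real ^ 'n ^ 'n) set" where
    "\<forall>W. finite (B W) \<and> (\<forall>y. (\<forall>b\<in>B W. b \<bullet> y = 0) \<longleftrightarrow> y \<in> span W)" ..
  then have B: "\<And>W. finite (B W)" "\<And>W y. (\<forall>b\<in>B W. b \<bullet> y = 0) \<longleftrightarrow> y \<in> span W" by simp_all
  \<comment> \<open>Besides the forms deciding membership, \<open>A\<close> holds equations of the
    finitely many small subspaces, so each cell lies in one of them.\<close>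
  define A where "A = A1 \<union> \<Union>(B ` ?\<W>)"
  have finA: "finite A" unfolding A_def using A1(1) finW B(1) by (intro finite_UnI finite_UN_I)
  have ne: "?S \<noteq> {}" using metric_products_base[OF uniform_matrix_metric[of 0]] by auto
  have det: "Y \<in> ?S" if "X \<in> ?S" "\<forall>a\<in>A. sgn (a \<bullet> X) = sgn (a \<bullet> Y)" for X Y
    using A1(2) that unfolding A_def by blast
  let ?F = "cell A ` ?S"
  have fan: "finite_polyhedral_fan ?F" "\<Union>?F = ?S"
    by (rule finite_polyhedral_fan_cells[OF finA closed_metric_products ne], rule det; assumption)+
  have "Max (aff_dim ` ?F) = int ?m"
  proof (rule antisym)
    have fin: "finite (aff_dim ` ?F)" using finite_cells[OF finA] by blast
    have "aff_dim (cell A X) \<le> int ?m" if X: "X \<in> ?S" for X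
    proof -
      obtain W where W: "W \<in> ?\<W>" "X \<in> span W" using subsetD[OF metric_products_low_dim X] by blast
      have "B W \<subseteq> A" using W(1) unfolding A_def by blast
      then have "aff_dim (cell A X) \<le> int (dim (span W))"
        by (rule aff_dim_cell_le[OF subspace_span W(2) _ B(2)])
      moreover have "dim (span W) \<le> ?m" using W(1) by simp
      ultimately show ?thesis by linarith
    qed
    then show "Max (aff_dim ` ?F) \<le> int ?m" using fin ne by (subst Max_le_iff) auto
    obtain X where X: "X \<in> ?S" "int ?m \<le> aff_dim (cell A X)" using metric_products_large_cell[OF finA] by blast
    have "aff_dim (cell A X) \<le> Max (aff_dim ` ?F)" using fin X(1) by (intro Max_ge) auto
    then show "int ?m \<le> Max (aff_dim ` ?F)" using X(2) by linarith
  qed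
  then show ?thesis using fan unfolding fan_dim_def by blast
qed

theorem theorem1p1:
  shows "(metric_products :: (real ^ 'n::finite ^ 'n) set) \<subseteq> {A. \<forall>i j. 0 \<le> A $ i $ j} \<and>
    (\<exists>F :: (real ^ 'n ^ 'n) set set. finite_polyhedral_fan F \<and>
       \<Union>F = metric_products \<and> fan_dim F = int (CARD('n) choose 2)) \<and>
    closure (ennreal_matrix ` metric_products) =
      (lossy_gossip_monoid :: (ennreal ^ 'n ^ 'n) set)"
proof (intro conjI)
  show "metric_products \<subseteq> {A :: real ^ 'n ^ 'n. \<forall>i j. 0 \<le> A $ i $ j}"
    using metric_products_nonneg by blast
qed (rule metric_products_fan closure_metric_products)+

end
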